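(* Let $F$ and $H$ be graphs with $r+1=\chi(F)>\chi(H)$, assume that $H$ is a forest that is both $F$-Turán-stable and $F$-Turán-good, and assume that $\mathrm{biex}(n,F)=O(1)$. Then for $n$ sufficiently large, $\mathrm{ex}(n,H,F)=\mathcal{N}(H,G)$ for some $n$-vertex $F$-free graph $G$ with $|E(G)|=\mathrm{ex}(n,F)$.
   Context: All graphs are finite and simple. $\mathrm{ex}(n,F)$ is the maximum number of edges in an $n$-vertex $F$-free graph. $\mathcal{N}(H,G)$ is the number of subgraphs of $G$ isomorphic to $H$, and $\mathrm{ex}(n,H,F)$ is the maximum of $\mathcal{N}(H,G)$ over $n$-vertex $F$-free graphs $G$. $T(n,r)$ is the Turán graph: the complete $r$-partite $n$-vertex graph with parts of sizes $\lfloor n/r\rfloor$ or $\lceil n/r\rceil$. $H$ is $F$-Turán-good if $\chi(H)<\chi(F)$ and $\mathrm{ex}(n,H,F)=\mathcal{N}(H,T(n,\chi(F)-1))$ for all sufficiently large $n$. The edit distance between two graphs on the same vertex set is the least number of edges one must add and delete to turn one into the other. $H$ is $F$-Turán-stable if every $n$-vertex $F$-free graph $G$ with $\mathcal{N}(H,G)\ge \mathrm{ex}(n,H,F)-o(n^{|V(H)|})$ has edit distance $o(n^2)$ from some graph on $V(G)$ isomorphic to $T(n,\chi(F)-1)$ (asymptotics as $n\to\infty$ with $F,H$ fixed). For a graph $F$ with $\chi(F)=r+1$, the decomposition family $\mathcal{D}(F)$ is the set of bipartite graphs obtained from $F$ by deleting $r-1$ color classes of a proper $(r+1)$-coloring of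 $F$, and $\mathrm{biex}(n,F)$ is the maximum number of edges in an $n$-vertex graph containing no member of $\mathcal{D}(F)$. *)

theory Defs
  imports Complex_Main
begin

type_synonym 'a graph = "'a set \<times> 'a set set"

definition verts :: "'a graph \<Rightarrow> 'a set" where "verts G = fst G"
definition edges :: "'a graph \<Rightarrow> 'a set set" where "edges G = snd G"

definition wf_graph :: "'a graph \<Rightarrow> bool" where
  "wf_graph G \<longleftrightarrow> finite (verts G) \<and> (\<forall>e\<in>edges G. e \<subseteq> verts G \<and> card e = 2)"

definition graph_iso :: "'a graph \<Rightarrow> 'b graph \<Rightarrow> bool" where
  "graph_iso G H \<longleftrightarrow> (\<exists>f. bij_betw f (verts G) (verts H) \<and>
      (\<forall>e. e \<subseteq> verts G \<longrightarrow> (e \<in> edges G \<longleftrightarrow> f ` e \<in> edges H)))"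

definition subgraph :: "'a graph \<Rightarrow> 'a graph \<Rightarrow> bool" where
  "subgraph S G \<longleftrightarrow> verts S \<subseteq> verts G \<and> edges S \<subseteq> edges G \<and>
      (\<forall>e\<in>edges S. e \<subseteq> verts S)"

definition count_copies :: "'a graph \<Rightarrow> 'b graph \<Rightarrow> nat" where
  "count_copies H G = card {S. subgraph S G \<and> graph_iso H S}"

definition free :: "'a graph \<Rightarrow> 'b graph \<Rightarrow> bool" where
  "free F G \<longleftrightarrow> count_copies F G = 0"

definition graphs_on :: "nat \<Rightarrow> nat graph set" where
  "graphs_on n = {G. wf_graph G \<and> verts G = {0..<n}}"

definition ex :: "nat \<Rightarrow> 'a graph \<Rightarrow> nat" where
  "ex n F = Max ((\<lambda>G. card (edges G)) ` {G \<in> graphs_on n. free F G})"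

definition gen_ex :: "nat \<Rightarrow> 'a graph \<Rightarrow> 'b graph \<Rightarrow> nat" where
  "gen_ex n H F = Max ((\<lambda>G. count_copies H G) ` {G \<in> graphs_on n. free F G})"

definition proper_coloring :: "'a graph \<Rightarrow> nat \<Rightarrow> ('a \<Rightarrow> nat) \<Rightarrow> bool" where
  "proper_coloring G k c \<longleftrightarrow> c ` verts G \<subseteq> {..<k} \<and>
      (\<forall>u v. {u, v} \<in> edges G \<longrightarrow> c u \<noteq> c v)"

definition chromatic :: "'a graph \<Rightarrow> nat" where
  "chromatic G = (LEAST k. \<exists>c. proper_coloring G k c)"

text \<open>Turan graph T(n,r): vertex i lies in part (i mod r); parts have sizes floor/ceil of n/r.\<close>
definition turan_graph :: "nat \<Rightarrow> nat \<Rightarrow> nat graph" where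
  "turan_graph n r = ({0..<n}, {{u, v} | u v. u < n \<and> v < n \<and> u mod r \<noteq> v mod r})"

definition edit_distance :: "'a graph \<Rightarrow> 'a graph \<Rightarrow> nat" where
  "edit_distance G G' = card (edges G - edges G') + card (edges G' - edges G)"

definition turan_good :: "'a graph \<Rightarrow> 'b graph \<Rightarrow> bool" where
  "turan_good H F \<longleftrightarrow> chromatic H < chromatic F \<and>
     (\<exists>n0. \<forall>n\<ge>n0. gen_ex n H F = count_copies H (turan_graph n (chromatic F - 1)))"

text \<open>Turan-stability, with the o(.) quantifiers spelled out in epsilon-delta form.\<close>
definition turan_stable :: "'a graph \<Rightarrow> 'b graph \<Rightarrow> bool" where
  "turan_stable H F \<longleftrightarrow> (\<forall>\<epsilon>>0. \<exists>\<delta>>0. \<exists>n0. \<forall>n\<ge>n0. \<forall>G\<in>graphs_on n.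
     free F G \<and> real (count_copies H G) \<ge> real (gen_ex n H F) - \<delta> * real n ^ card (verts H)
     \<longrightarrow> (\<exists>T\<in>graphs_on n. graph_iso T (turan_graph n (chromatic F - 1)) \<and>
            real (edit_distance G T) \<le> \<epsilon> * real n ^ 2))"

text \<open>Decomposition family: for a proper (r+1)-colouring, delete r-1 colour classes,
  i.e. keep the subgraph induced by two distinct colour classes i, j.\<close>
definition induced :: "'a graph \<Rightarrow> 'a set \<Rightarrow> 'a graph" where
  "induced G U = (verts G \<inter> U, {e \<in> edges G. e \<subseteq> U})"

definition decomp_family :: "'a graph \<Rightarrow> 'a graph set" where
  "decomp_family F = {induced F {v. c v = i \<or> c v = j} | c i j.
      proper_coloring F (chromatic F) c \<and> i < chromatic F \<and> j < chromatic F \<and> i \<noteq> j}"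

definition biex :: "nat \<Rightarrow> 'a graph \<Rightarrow> nat" where
  "biex n F = Max ((\<lambda>G. card (edges G)) `
      {G \<in> graphs_on n. \<forall>D\<in>decomp_family F. free D G})"

definition cycle_graph :: "nat \<Rightarrow> nat graph" where
  "cycle_graph k = ({0..<k}, {{i, (i + 1) mod k} | i. i < k})"

definition forest :: "'a graph \<Rightarrow> bool" where
  "forest G \<longleftrightarrow> (\<forall>k\<ge>3. free (cycle_graph k) G)"

end

(* Since biex(n,F) is bounded, r >= 1.  If H has no edge, every n-vertex graph has the same number of
   copies of H.  Otherwise T(n,r) itself is the required graph.  If T(n,r) + e were F-free for all
   edges e inside a part, a leaf edge of the forest H could be placed on e, contradicting that H is
   F-Turan-good; so T(n,r) + e contains F for some n and e, that is, F has a colour-critical edge.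
   It remains to show ex(n,F) = e(T(n,r)), as in Simonovits' theorem.  An F-free graph with more
   edges contains a large subgraph K, still denser than the Turan graph, whose minimum degree is
   nearly that of the Turan graph.  Embedding the forest H greedily, K has almost as many copies of H
   as the Turan graph, so by stability K is close to a Turan graph.  Each vertex then has few
   neighbours in some part, and an edge inside one of the resulting classes would complete a copy of
   T(n,r) + e.  Hence K is r-partite, contradicting its number of edges. *)

theory Submission
  imports Defs "HOL-Library.FuncSet"
begin

section \<open>Embeddings and copies\<close>

text \<open>Stability measures a graph by its number of copies of H, while the assumption to be
  refuted concerns only its number of edges. Minimum degree is the bridge: a forest can be built up
  so that each new vertex has at most one earlier neighbour, so up to lower order terms its
  embeddings are governed by degrees alone. Stability also tolerates o(m^2) edits, so some vertices
  may be misplaced in the Turan partition. The final colouring is therefore not that partition: each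
  vertex moves to a part in which it has few neighbours, and the minimum degree then makes it
  adjacent to almost everything outside that part. Such a part exists because a vertex with many
  neighbours in every part could itself be an end of the extra edge in T(l, r) + e. Since l is
  fixed, "few" and "many" are thresholds affine in a tolerance d, a small fraction of m which bounds
  both the number of exceptional vertices and the number of cross edges missing at each other
  vertex.\<close>

definition embedding :: "('a \<Rightarrow> 'b) \<Rightarrow> 'a graph \<Rightarrow> 'b graph \<Rightarrow> bool" where
  "embedding f H G \<longleftrightarrow> inj_on f (verts H) \<and> f ` verts H \<subseteq> verts G \<and> (\<forall>e\<in>edges H. f ` e \<in> edges G)"

definition image_graph :: "('a \<Rightarrow> 'b) \<Rightarrow> 'a graph \<Rightarrow> 'b graph" where
  "image_graph f H = (f ` verts H, image f ` edges H)"

definition neighbours :: "'a graph \<Rightarrow> 'a \<Rightarrow> 'a set" where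
  "neighbours G v = {w. {v, w} \<in> edges G}"

text \<open>Extensional functions are determined by their values on \<open>verts H\<close>, so there
  are finitely many of them and they can be counted.\<close>

definition embeddings :: "'a graph \<Rightarrow> 'b graph \<Rightarrow> ('a \<Rightarrow> 'b) set" where
  "embeddings H G = {f \<in> extensional (verts H). embedding f H G}"

lemma verts_Pair [simp]: "verts (V, E) = V"
  and edges_Pair [simp]: "edges (V, E) = E"
  by (simp_all add: verts_def edges_def)

lemma graph_eqI: "verts G = verts H \<Longrightarrow> edges G = edges H \<Longrightarrow> G = H"
  by (simp add: verts_def edges_def prod_eq_iff)

lemma wf_graph_finite: "wf_graph G \<Longrightarrow> finite (verts G)"
  and wf_graph_edge_subset: "wf_graph G \<Longrightarrow> e \<in> edges G \<Longrightarrow> e \<subseteq> verts G"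
  and wf_graph_edge_card: "wf_graph G \<Longrightarrow> e \<in> edges G \<Longrightarrow> card e = 2"
  by (auto simp: wf_graph_def)

lemma wf_graph_finite_edges: "wf_graph G \<Longrightarrow> finite (edges G)"
  by (rule finite_subset[of _ "Pow (verts G)"]) (auto simp: wf_graph_def)

lemma wf_graph_edgeE:
  assumes "wf_graph G" "e \<in> edges G"
  obtains u v where "e = {u, v}" "u \<noteq> v" "u \<in> verts G" "v \<in> verts G"
  using assms by (metis card_2_iff insert_subset wf_graph_edge_card wf_graph_edge_subset)

lemma wf_graph_edgeD:
  assumes "wf_graph G" "{u, v} \<in> edges G"
  shows "u \<in> verts G" "v \<in> verts G" "u \<noteq> v"
  using wf_graph_edge_subset[OF assms] wf_graph_edge_card[OF assms] by (auto simp: card_insert_if split: if_splits)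

lemma neighbours_subset: "wf_graph G \<Longrightarrow> neighbours G v \<subseteq> verts G - {v}"
  by (auto simp: neighbours_def dest: wf_graph_edgeD)

lemma finite_neighbours: "wf_graph G \<Longrightarrow> finite (neighbours G v)"
  by (meson finite_Diff finite_subset neighbours_subset wf_graph_finite)

lemma embedding_iff_image_graph:
  "embedding f H G \<longleftrightarrow> inj_on f (verts H) \<and>
     verts (image_graph f H) \<subseteq> verts G \<and> edges (image_graph f H) \<subseteq> edges G"
  by (auto simp: embedding_def image_graph_def)

lemma embedding_comp:
  assumes "embedding f F G" "embedding g G K"
  shows "embedding (g \<circ> f) F K"
proof -
  have "(g \<circ> f) ` e \<in> edges K" if "e \<in> edges F" for e
    using assms that unfolding image_comp[symmetric] by (simp add: embedding_def)
  moreover have "inj_on (g \<circ> f) (verts F)"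
    using assms by (auto simp: embedding_def intro: comp_inj_on inj_on_subset)
  moreover have "(g \<circ> f) ` verts F \<subseteq> verts K"
    using assms unfolding embedding_def by fastforce
  ultimately show ?thesis by (simp add: embedding_def)
qed

text \<open>A copy is the image graph of any isomorphism onto it, cut down to an extensional
  function. \<open>graph_iso\<close> speaks only of subsets of \<open>verts H\<close>; that edges
  are such subsets, or images of them, comes from well-formedness of \<open>H\<close> and from
  \<open>subgraph\<close> for \<open>S\<close>.\<close>

lemma copies_eq_image:
  assumes "wf_graph H"
  shows "{S. subgraph S G \<and> graph_iso H S} = (\<lambda>f. image_graph f H) ` embeddings H G"
proof (intro equalityI subsetI)
  fix S assume "S \<in> {S. subgraph S G \<and> graph_iso H S}"
  then obtain f where S: "subgraph S G" and f: "bij_betw f (verts H) (verts S)"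
    and E: "\<And>e. e \<subseteq> verts H \<Longrightarrow> e \<in> edges H \<longleftrightarrow> f ` e \<in> edges S"
    by (auto simp: graph_iso_def)
  define g where "g = restrict f (verts H)"
  have g: "g ` e = f ` e" if "e \<subseteq> verts H" for e
    using that by (auto simp: g_def subset_eq)
  have sub: "e \<subseteq> verts H" if "e \<in> edges H" for e
    using that assms by (rule wf_graph_edge_subset[rotated])
  have inj: "inj_on g (verts H)" using f by (simp add: g_def bij_betw_def)
  have gV: "g ` verts H = verts S" using f by (simp add: g bij_betw_def)
  have gE: "g ` e \<in> edges S" if "e \<in> edges H" for e
    using that E[OF sub[OF that]] g[OF sub[OF that]] by simp
  have "image g ` edges H = edges S"
  proof (intro equalityI subsetI)
    fix e assume "e \<in> image g ` edges H"
    then show "e \<in> edges S" using gE by auto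
  next
    fix e assume e: "e \<in> edges S"
    then have "e \<subseteq> g ` verts H" using S gV by (auto simp: subgraph_def)
    then obtain d where "d \<subseteq> verts H" "e = g ` d" by (meson subset_imageE)
    then show "e \<in> image g ` edges H" using E[of d] e g[of d] by (metis imageI)
  qed
  then have "S = image_graph g H" using gV by (intro graph_eqI) (auto simp: image_graph_def)
  moreover have "g \<in> embeddings H G"
    using inj gV gE S unfolding embeddings_def embedding_def subgraph_def by (auto simp: g_def)
  ultimately show "S \<in> (\<lambda>f. image_graph f H) ` embeddings H G" by blast
next
  fix S assume "S \<in> (\<lambda>f. image_graph f H) ` embeddings H G"
  then obtain f where S: "S = image_graph f H" and f: "embedding f H G"
    by (auto simp: embeddings_def)
  have sub: "e \<subseteq> verts H" if "e \<in> edges H" for e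
    using that assms by (rule wf_graph_edge_subset[rotated])
  have "subgraph S G"
    using f sub by (auto simp: S image_graph_def embedding_def subgraph_def)
  moreover have "graph_iso H S"
    unfolding graph_iso_def
  proof (intro exI conjI allI impI)
    show "bij_betw f (verts H) (verts S)"
      using f by (auto simp: S image_graph_def embedding_def bij_betw_def)
    fix e assume e: "e \<subseteq> verts H"
    show "e \<in> edges H \<longleftrightarrow> f ` e \<in> edges S"
      using f e sub by (auto simp: S image_graph_def embedding_def inj_on_image_eq_iff)
  qed
  ultimately show "S \<in> {S. subgraph S G \<and> graph_iso H S}" by simp
qed

lemma embeddings_subset_PiE: "embeddings H G \<subseteq> verts H \<rightarrow>\<^sub>E verts G"
  by (auto simp: embeddings_def embedding_def PiE_def)

lemma finite_embeddings:
  assumes "wf_graph H" "wf_graph G"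
  shows "finite (embeddings H G)"
  by (rule finite_subset[OF embeddings_subset_PiE]) (intro finite_PiE wf_graph_finite assms)

lemma card_embeddings_le:
  assumes "wf_graph H" "wf_graph G"
  shows "card (embeddings H G) \<le> card (verts G) ^ card (verts H)"
proof -
  have "card (embeddings H G) \<le> card (verts H \<rightarrow>\<^sub>E verts G)"
    by (intro card_mono embeddings_subset_PiE finite_PiE wf_graph_finite assms)
  then show ?thesis by (simp add: card_funcsetE wf_graph_finite assms)
qed

lemma restrict_embedding:
  assumes "wf_graph H" "embedding f H G"
  shows "restrict f (verts H) \<in> embeddings H G"
proof -
  have "restrict f (verts H) ` e = f ` e" if "e \<in> edges H" for e
    using wf_graph_edge_subset[OF assms(1) that] by (auto simp: subset_eq)
  then show ?thesis using assms(2) by (auto simp: embeddings_def embedding_def)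
qed

text \<open>\<open>free\<close> says that a cardinality is 0, which would also hold for an infinite
  set of copies; finiteness of the set of embeddings excludes this.\<close>

lemma free_iff_no_embedding:
  assumes "wf_graph H" "wf_graph G"
  shows "free H G \<longleftrightarrow> \<not> (\<exists>f. embedding f H G)"
proof -
  have "free H G \<longleftrightarrow> embeddings H G = {}"
    unfolding free_def count_copies_def copies_eq_image[OF assms(1)]
    using finite_embeddings[OF assms] by simp
  also have "\<dots> \<longleftrightarrow> \<not> (\<exists>f. embedding f H G)"
    using restrict_embedding[OF assms(1), of _ G] unfolding embeddings_def by blast
  finally show ?thesis .
qed

section \<open>Copies counted by embeddings modulo automorphisms\<close>

definition automorphisms :: "'a graph \<Rightarrow> ('a \<Rightarrow> 'a) set" where
  "automorphisms H = {g \<in> extensional (verts H). inj_on g (verts H) \<and> image_graph g H = H}"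

lemma card_automorphisms_pos:
  assumes "wf_graph H"
  shows "card (automorphisms H) > 0"
proof -
  let ?i = "restrict id (verts H)"
  have "?i ` e = e" if "e \<in> edges H" for e
    using wf_graph_edge_subset[OF assms that] by (auto simp: subset_eq)
  then have "?i \<in> automorphisms H"
    by (auto simp: automorphisms_def image_graph_def intro!: graph_eqI)
  moreover have "finite (automorphisms H)"
  proof (rule finite_subset)
    have "g ` verts H = verts H" if "image_graph g H = H" for g
      using arg_cong[OF that, of verts] by (simp add: image_graph_def)
    then show "automorphisms H \<subseteq> verts H \<rightarrow>\<^sub>E verts H"
      unfolding automorphisms_def PiE_def by blast
  qed (intro finite_PiE wf_graph_finite assms)
  ultimately show ?thesis using card_gt_0_iff by blast
qed

lemma image_graph_comp: "image_graph (f \<circ> g) H = image_graph f (image_graph g H)"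
  by (simp add: image_graph_def image_comp image_image)

lemma image_graph_cong:
  assumes "wf_graph H" "\<And>v. v \<in> verts H \<Longrightarrow> f v = g v"
  shows "image_graph f H = image_graph g H"
proof -
  have "f ` e = g ` e" if "e \<in> edges H" for e
    using wf_graph_edge_subset[OF assms(1) that] assms(2) by (intro image_cong) auto
  then show ?thesis using assms(2) by (simp add: image_graph_def cong: image_cong)
qed

lemma image_graph_id: "image_graph id H = H"
  by (rule graph_eqI) (auto simp: image_graph_def)

text \<open>Any two injections with the same image graph differ by an automorphism: \<open>g\<close>
  corresponds to \<open>f0 \<circ> g\<close>, and composing with the inverse of \<open>f0\<close>
  recovers \<open>g\<close>.\<close>

lemma card_embedding_fibre:
  assumes H: "wf_graph H" and f0: "inj_on f0 (verts H)"
  shows "card {f \<in> extensional (verts H). inj_on f (verts H) \<and> image_graph f H = image_graph f0 H}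
      = card (automorphisms H)"
proof -
  let ?V = "verts H"
  let ?F = "{f \<in> extensional ?V. inj_on f ?V \<and> image_graph f H = image_graph f0 H}"
  let ?j = "inv_into ?V f0"
  have aut: "g ` ?V = ?V" if "g \<in> automorphisms H" for g
  proof -
    have "image_graph g H = H" using that by (simp add: automorphisms_def)
    from arg_cong[OF this, of verts] show ?thesis by (simp add: image_graph_def)
  qed
  have fib: "f ` ?V = f0 ` ?V" if "f \<in> ?F" for f
    using that by (auto simp: image_graph_def)
  have "bij_betw (\<lambda>g. restrict (f0 \<circ> g) ?V) (automorphisms H) ?F"
  proof (rule bij_betw_byWitness[where f' = "\<lambda>f. restrict (?j \<circ> f) ?V"])
    show "\<forall>g\<in>automorphisms H. restrict (?j \<circ> restrict (f0 \<circ> g) ?V) ?V = g"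
    proof
      fix g assume g: "g \<in> automorphisms H"
      show "restrict (?j \<circ> restrict (f0 \<circ> g) ?V) ?V = g"
      proof (rule extensionalityI[of _ ?V])
        show "g \<in> extensional ?V" using g by (simp add: automorphisms_def)
        fix x assume "x \<in> ?V"
        moreover from this have "g x \<in> ?V" using aut[OF g] by blast
        ultimately show "restrict (?j \<circ> restrict (f0 \<circ> g) ?V) ?V x = g x"
          using f0 by simp
      qed simp
    qed
    show "\<forall>f\<in>?F. restrict (f0 \<circ> restrict (?j \<circ> f) ?V) ?V = f"
    proof
      fix f assume f: "f \<in> ?F"
      show "restrict (f0 \<circ> restrict (?j \<circ> f) ?V) ?V = f"
      proof (rule extensionalityI[of _ ?V])
        show "f \<in> extensional ?V" using f by simp
        fix x assume x: "x \<in> ?V"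
        then have "f x \<in> f0 ` ?V" using fib[OF f] by blast
        with x show "restrict (f0 \<circ> restrict (?j \<circ> f) ?V) ?V x = f x"
          by (simp add: f_inv_into_f)
      qed simp
    qed
    show "(\<lambda>g. restrict (f0 \<circ> g) ?V) ` automorphisms H \<subseteq> ?F"
    proof (intro image_subsetI CollectI conjI)
      fix g assume g: "g \<in> automorphisms H"
      then have "inj_on (f0 \<circ> g) ?V"
        using f0 aut[OF g] by (intro comp_inj_on) (auto simp: automorphisms_def)
      then show "inj_on (restrict (f0 \<circ> g) ?V) ?V" by simp
      have "image_graph (restrict (f0 \<circ> g) ?V) H = image_graph (f0 \<circ> g) H"
        by (rule image_graph_cong[OF H]) simp
      then show "image_graph (restrict (f0 \<circ> g) ?V) H = image_graph f0 H"
        using g by (simp add: image_graph_comp automorphisms_def)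
    qed simp
    show "(\<lambda>f. restrict (?j \<circ> f) ?V) ` ?F \<subseteq> automorphisms H"
    proof (intro image_subsetI)
      fix f assume f: "f \<in> ?F"
      have "inj_on (?j \<circ> f) ?V"
        using f fib[OF f] by (intro comp_inj_on) (auto simp: inj_on_inv_into)
      moreover have "image_graph (restrict (?j \<circ> f) ?V) H = H"
      proof -
        have "image_graph (restrict (?j \<circ> f) ?V) H = image_graph (?j \<circ> f) H"
          by (rule image_graph_cong[OF H]) simp
        also have "\<dots> = image_graph (?j \<circ> f0) H"
          using f by (simp add: image_graph_comp)
        also have "\<dots> = image_graph id H"
          using f0 by (intro image_graph_cong[OF H]) simp
        finally show ?thesis by (simp add: image_graph_id)
      qed
      ultimately show "restrict (?j \<circ> f) ?V \<in> automorphisms H"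
        by (simp add: automorphisms_def)
    qed
  qed
  then show ?thesis by (simp add: bij_betw_same_card)
qed

text \<open>This reduces comparisons between numbers of copies to numbers of embeddings, which can
  be built one vertex at a time.\<close>

lemma card_embeddings_eq:
  assumes H: "wf_graph H" and G: "wf_graph G"
  shows "card (embeddings H G) = card (automorphisms H) * count_copies H G"
proof -
  let ?i = "\<lambda>f. image_graph f H"
  have fib: "{f \<in> embeddings H G. ?i f = ?i f0}
      = {f \<in> extensional (verts H). inj_on f (verts H) \<and> ?i f = ?i f0}" if "f0 \<in> embeddings H G" for f0
  proof -
    have "embedding f0 H G" using that by (simp add: embeddings_def)
    then have "embedding f H G \<longleftrightarrow> inj_on f (verts H)" if "?i f = ?i f0" for f
      unfolding embedding_iff_image_graph that by simp
    then show ?thesis unfolding embeddings_def by blast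
  qed
  have "card (embeddings H G) = (\<Sum>S\<in>?i ` embeddings H G. card {f \<in> embeddings H G. ?i f = S})"
    unfolding card_eq_sum by (rule sum.image_gen[OF finite_embeddings[OF H G]])
  also have "\<dots> = (\<Sum>S\<in>?i ` embeddings H G. card (automorphisms H))"
  proof (rule sum.cong[OF refl])
    fix S assume "S \<in> ?i ` embeddings H G"
    then obtain f0 where f0: "f0 \<in> embeddings H G" "S = ?i f0" by blast
    then have "inj_on f0 (verts H)" by (simp add: embeddings_def embedding_def)
    then show "card {f \<in> embeddings H G. ?i f = S} = card (automorphisms H)"
      unfolding f0(2) fib[OF f0(1)] by (rule card_embedding_fibre[OF H])
  qed
  finally show ?thesis unfolding count_copies_def copies_eq_image[OF H] by simp
qed

section \<open>Turan graphs\<close>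

lemma card_edges_within_remove:
  assumes "finite E" "v \<in> U" "\<forall>e\<in>E. card e = 2"
  shows "card {e \<in> E. e \<subseteq> U} = card {e \<in> E. e \<subseteq> U - {v}} + card {w \<in> U. {v, w} \<in> E}"
proof -
  have split: "{e \<in> E. e \<subseteq> U} = {e \<in> E. e \<subseteq> U - {v}} \<union> (\<lambda>w. {v, w}) ` {w \<in> U. {v, w} \<in> E}"
  proof (intro equalityI subsetI)
    fix e assume e: "e \<in> {e \<in> E. e \<subseteq> U}"
    show "e \<in> {e \<in> E. e \<subseteq> U - {v}} \<union> (\<lambda>w. {v, w}) ` {w \<in> U. {v, w} \<in> E}"
    proof (cases "v \<in> e")
      case True
      from e assms(3) obtain a b where "e = {a, b}" by (auto simp: card_2_iff)
      with True obtain w where "e = {v, w}" by auto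
      with e show ?thesis by auto
    qed (use e in auto)
  qed (use assms(2) in auto)
  have "inj_on (\<lambda>w. {v, w}) {w \<in> U. {v, w} \<in> E}"
    by (auto simp: inj_on_def doubleton_eq_iff)
  moreover have "{e \<in> E. e \<subseteq> U - {v}} \<inter> (\<lambda>w. {v, w}) ` {w \<in> U. {v, w} \<in> E} = {}" by auto
  moreover have "finite ((\<lambda>w. {v, w}) ` {w \<in> U. {v, w} \<in> E})"
    by (rule finite_subset[OF _ assms(1)]) auto
  ultimately show ?thesis
    using assms(1) unfolding split by (subst card_Un_disjoint) (auto simp: card_image)
qed

lemma card_residue_class_ge:
  assumes "i < r"
  shows "m div r \<le> card {w. w < m \<and> w mod r = i}"
proof -
  have "(\<lambda>q. q * r + i) ` {..<m div r} \<subseteq> {w. w < m \<and> w mod r = i}"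
  proof (clarsimp simp: assms)
    fix q assume "q < m div r"
    then have "Suc q * r \<le> m div r * r" by (intro mult_le_mono1) simp
    also have "\<dots> \<le> m" by simp
    finally show "q * r + i < m" using assms by simp
  qed
  moreover have "inj_on (\<lambda>q. q * r + i) {..<m div r}" using assms by (auto simp: inj_on_def)
  ultimately show ?thesis using card_inj_on_le[of "\<lambda>q. q * r + i" "{..<m div r}"] by simp
qed

lemma card_residue_class_le: "card {w. w < m \<and> w mod r = m mod r} \<le> m div r"
proof -
  have less: "w div r < m div r" if "w < m" "w mod r = m mod r" for w
  proof -
    have "w div r \<noteq> m div r"
      using that div_mult_mod_eq[of w r] div_mult_mod_eq[of m r] by force
    moreover have "w div r \<le> m div r" using that(1) by (intro div_le_mono) simp
    ultimately show ?thesis by simp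
  qed
  have "inj_on (\<lambda>w. w div r) {w. w < m \<and> w mod r = m mod r}"
  proof (rule inj_onI)
    fix x y assume "x \<in> {w. w < m \<and> w mod r = m mod r}" "y \<in> {w. w < m \<and> w mod r = m mod r}"
      "x div r = y div r"
    then show "x = y" using div_mult_mod_eq[of x r] div_mult_mod_eq[of y r] by simp
  qed
  then show ?thesis
    using card_inj_on_le[of "\<lambda>w. w div r" "{w. w < m \<and> w mod r = m mod r}" "{..<m div r}"] less
    by auto
qed

lemma turan_graph_edge_iff:
  "{u, v} \<in> edges (turan_graph n r) \<longleftrightarrow> u < n \<and> v < n \<and> u mod r \<noteq> v mod r"
  by (auto simp: turan_graph_def doubleton_eq_iff)

lemma verts_turan_graph [simp]: "verts (turan_graph n r) = {0..<n}"
  by (simp add: turan_graph_def)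

lemma wf_turan_graph: "wf_graph (turan_graph n r)"
  by (auto simp: wf_graph_def turan_graph_def card_insert_if)

lemma turan_graph_in_graphs_on: "turan_graph n r \<in> graphs_on n"
  by (simp add: graphs_on_def wf_turan_graph)

text \<open>The new vertex \<open>m\<close> is joined to all earlier vertices outside its residue
  class, which contains at most \<open>m div r\<close> of them.\<close>

lemma card_edges_turan_graph_Suc:
  "card (edges (turan_graph m r)) + m \<le> card (edges (turan_graph (Suc m) r)) + m div r"
proof -
  let ?T = "turan_graph (Suc m) r"
  have "card (edges ?T) = card {e \<in> edges ?T. e \<subseteq> {0..<Suc m}}"
    using wf_graph_edge_subset[OF wf_turan_graph] by (intro arg_cong[of _ _ card]) auto
  also have "\<dots> = card {e \<in> edges ?T. e \<subseteq> {0..<Suc m} - {m}} + card {w \<in> {0..<Suc m}. {m, w} \<in> edges ?T}"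
    using wf_graph_finite_edges[OF wf_turan_graph] wf_graph_edge_card[OF wf_turan_graph]
    by (intro card_edges_within_remove) auto
  also have "{e \<in> edges ?T. e \<subseteq> {0..<Suc m} - {m}} = edges (turan_graph m r)"
  proof (intro equalityI subsetI)
    fix e assume e: "e \<in> {e \<in> edges ?T. e \<subseteq> {0..<Suc m} - {m}}"
    then obtain u v where uv: "e = {u, v}" using wf_graph_edgeE[OF wf_turan_graph] by blast
    show "e \<in> edges (turan_graph m r)" using e unfolding uv by (simp add: turan_graph_edge_iff)
  next
    fix e assume e: "e \<in> edges (turan_graph m r)"
    then obtain u v where uv: "e = {u, v}" using wf_graph_edgeE[OF wf_turan_graph] by blast
    show "e \<in> {e \<in> edges ?T. e \<subseteq> {0..<Suc m} - {m}}"
      using e unfolding uv by (auto simp: turan_graph_edge_iff)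
  qed
  finally have *: "card (edges ?T) =
    card (edges (turan_graph m r)) + card {w \<in> {0..<Suc m}. {m, w} \<in> edges ?T}" .
  have "{0..<m} \<subseteq> {w \<in> {0..<Suc m}. {m, w} \<in> edges ?T} \<union> {w. w < m \<and> w mod r = m mod r}"
    by (auto simp: turan_graph_edge_iff)
  then have "card {0..<m} \<le> card ({w \<in> {0..<Suc m}. {m, w} \<in> edges ?T} \<union> {w. w < m \<and> w mod r = m mod r})"
    by (intro card_mono) auto
  also have "\<dots> \<le> card {w \<in> {0..<Suc m}. {m, w} \<in> edges ?T} + m div r"
    using card_residue_class_le by (rule order.trans[OF card_Un_le add_left_mono])
  finally show ?thesis using * by simp
qed

lemma ex_large_fibre:
  assumes "finite U" "q ` U \<subseteq> {..<r::nat}" "U \<noteq> {}"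
  obtains i where "i < r" "card U \<le> r * card {v \<in> U. q v = i}"
proof (rule ccontr)
  assume "\<not> thesis"
  then have *: "\<And>i. i < r \<Longrightarrow> r * card {v \<in> U. q v = i} < card U" using that by force
  have "r > 0" using assms by auto
  have "r * card U = (\<Sum>i<r. r * card {v \<in> U. q v = i})"
    using assms sum.group[of U "{..<r}" q "\<lambda>_. 1::nat"] by (simp add: sum_distrib_left[symmetric])
  also have "\<dots> < (\<Sum>i<r. card U)" using * \<open>r > 0\<close> by (intro sum_strict_mono) auto
  finally show False by simp
qed

text \<open>Delete a vertex from a class of at least average size. That class has more than
  \<open>m div r\<close> vertices, so the deleted vertex has degree at most
  \<open>m - m div r\<close>, no more than the Turan graph gains when it grows from \<open>m\<close>
  to \<open>Suc m\<close> vertices.\<close>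

lemma card_edges_partite_le:
  assumes "finite E" "\<forall>e\<in>E. card e = 2" "finite U" "q ` U \<subseteq> {..<r}"
    and "\<And>u v. u \<in> U \<Longrightarrow> v \<in> U \<Longrightarrow> {u, v} \<in> E \<Longrightarrow> q u \<noteq> q v"
  shows "card {e \<in> E. e \<subseteq> U} \<le> card (edges (turan_graph (card U) r))"
  using assms(3-5)
proof (induction "card U" arbitrary: U)
  case 0
  then have "{e \<in> E. e \<subseteq> U} = {}" using assms(2) by auto
  then show ?case by (metis card.empty le0)
next
  case (Suc m)
  then have "U \<noteq> {}" by auto
  then obtain i where i: "card U \<le> r * card {v \<in> U. q v = i}"
    using Suc.prems ex_large_fibre[of U q r] by metis
  have "{v \<in> U. q v = i} \<noteq> {}"
  proof
    assume "{v \<in> U. q v = i} = {}"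
    then have "card {v \<in> U. q v = i} = 0" by (metis card.empty)
    then show False using i Suc.hyps(2) by simp
  qed
  then obtain v where v: "v \<in> U" "q v = i" by blast
  have class_size: "m div r < card {v \<in> U. q v = i}"
    using i Suc.hyps(2) by (intro less_mult_imp_div_less) (simp add: mult.commute)
  have "{w \<in> U. {v, w} \<in> E} \<subseteq> U - {v \<in> U. q v = i}" using Suc.prems(3)[of v] v by force
  then have "card {w \<in> U. {v, w} \<in> E} \<le> card (U - {v \<in> U. q v = i})"
    using Suc.prems(1) by (intro card_mono) auto
  also have "\<dots> = card U - card {v \<in> U. q v = i}"
    using Suc.prems(1) by (intro card_Diff_subset) auto
  finally have deg: "card {w \<in> U. {v, w} \<in> E} \<le> m - m div r" using class_size Suc.hyps(2) by simp
  have cardm: "card (U - {v}) = m" using Suc.hyps(2) Suc.prems(1) v by (simp add: card_Diff_singleton)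
  have "card {e \<in> E. e \<subseteq> U - {v}} \<le> card (edges (turan_graph (card (U - {v})) r))"
    using cardm Suc.prems by (intro Suc.hyps(1)) auto
  then have "card {e \<in> E. e \<subseteq> U - {v}} \<le> card (edges (turan_graph m r))" by (simp only: cardm)
  moreover have "card {e \<in> E. e \<subseteq> U} = card {e \<in> E. e \<subseteq> U - {v}} + card {w \<in> U. {v, w} \<in> E}"
    using assms v by (intro card_edges_within_remove) auto
  moreover have "m div r \<le> m" by simp
  ultimately show ?case
    using deg card_edges_turan_graph_Suc[of m r] unfolding Suc.hyps(2)[symmetric] by linarith
qed

text \<open>Greedy choice: when the set inside \<open>A s\<close> is chosen, fewer than
  \<open>r\<close> sets of \<open>t\<close> vertices are already fixed, and each of their vertices
  rules out at most \<open>d\<close> candidates, so \<open>t\<close> of the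
  \<open>r * t * d + t\<close> survive.\<close>

lemma ex_complete_partite_subset:
  fixes A :: "nat \<Rightarrow> 'a set"
  assumes fin: "\<And>i. i < r \<Longrightarrow> finite (A i)"
    and large: "\<And>i. i < r \<Longrightarrow> card (A i) \<ge> r * t * d + t"
    and miss: "\<And>i j x. i < r \<Longrightarrow> j < r \<Longrightarrow> i \<noteq> j \<Longrightarrow> x \<in> A i \<Longrightarrow> card {y \<in> A j. {x, y} \<notin> E} \<le> d"
  obtains B where "\<And>i. i < r \<Longrightarrow> B i \<subseteq> A i" "\<And>i. i < r \<Longrightarrow> card (B i) = t"
    "\<And>i j x y. i < r \<Longrightarrow> j < r \<Longrightarrow> i \<noteq> j \<Longrightarrow> x \<in> B i \<Longrightarrow> y \<in> B j \<Longrightarrow> {x, y} \<in> E"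
proof -
  have "\<exists>B. (\<forall>i<s. B i \<subseteq> A i \<and> card (B i) = t) \<and>
      (\<forall>i<s. \<forall>j<s. i \<noteq> j \<longrightarrow> (\<forall>x\<in>B i. \<forall>y\<in>B j. {x, y} \<in> E))" if "s \<le> r" for s
    using that
  proof (induction s)
    case (Suc s)
    from Suc.IH[OF Suc_leD[OF Suc.prems]] obtain B where "\<forall>i<s. B i \<subseteq> A i \<and> card (B i) = t"
      "\<forall>i<s. \<forall>j<s. i \<noteq> j \<longrightarrow> (\<forall>x\<in>B i. \<forall>y\<in>B j. {x, y} \<in> E)"
      by (elim exE conjE)
    then have B: "\<And>i. i < s \<Longrightarrow> B i \<subseteq> A i" "\<And>i. i < s \<Longrightarrow> card (B i) = t"
      "\<And>i j x y. i < s \<Longrightarrow> j < s \<Longrightarrow> i \<noteq> j \<Longrightarrow> x \<in> B i \<Longrightarrow> y \<in> B j \<Longrightarrow> {x, y} \<in> E"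
      by simp_all
    define M where "M x = {y \<in> A s. {x, y} \<notin> E}" for x
    have finB: "finite (B i)" if "i < s" for i
      using that B(1) fin Suc.prems by (meson finite_subset less_le_trans Suc_leD)
    have finM: "finite (M x)" for x using fin Suc.prems by (simp add: M_def)
    have "card (\<Union>i<s. \<Union>x\<in>B i. M x) \<le> (\<Sum>i<s. card (\<Union>x\<in>B i. M x))" by (rule card_UN_le) simp
    also have "\<dots> \<le> (\<Sum>i<s. t * d)"
    proof (rule sum_mono)
      fix i assume "i \<in> {..<s}"
      then have i: "i < s" by simp
      have "card (\<Union>x\<in>B i. M x) \<le> (\<Sum>x\<in>B i. card (M x))" using finB[OF i] by (rule card_UN_le)
      also have "\<dots> \<le> (\<Sum>x\<in>B i. d)"
        using miss[of i s] i B(1) Suc.prems by (intro sum_mono) (auto simp: M_def)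
      finally show "card (\<Union>x\<in>B i. M x) \<le> t * d" using B(2)[OF i] by simp
    qed
    also have "\<dots> \<le> r * t * d" using Suc.prems by (simp add: mult.assoc)
    finally have "card (\<Union>i<s. \<Union>x\<in>B i. M x) \<le> r * t * d" .
    moreover have "card (A s) - card (\<Union>i<s. \<Union>x\<in>B i. M x) \<le> card (A s - (\<Union>i<s. \<Union>x\<in>B i. M x))"
      using finM finB by (intro diff_card_le_card_Diff) auto
    moreover have "card (A s) \<ge> r * t * d + t" using large Suc.prems by simp
    ultimately have "t \<le> card (A s - (\<Union>i<s. \<Union>x\<in>B i. M x))" by linarith
    then obtain C where C: "C \<subseteq> A s - (\<Union>i<s. \<Union>x\<in>B i. M x)" "card C = t"
      by (meson obtain_subset_with_card_n)
    have CE: "{x, y} \<in> E" if "i < s" "x \<in> B i" "y \<in> C" for i x y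
      using that C(1) by (auto simp: M_def)
    have CE': "{y, x} \<in> E" if "i < s" "x \<in> B i" "y \<in> C" for i x y
      using CE[OF that] by (simp add: insert_commute)
    show ?case
    proof (intro exI[of _ "B(s := C)"] conjI allI impI ballI)
      fix i assume "i < Suc s"
      then show "(B(s := C)) i \<subseteq> A i" "card ((B(s := C)) i) = t"
        using B C by (auto simp: less_Suc_eq)
    next
      fix i j x y
      assume "i < Suc s" "j < Suc s" "i \<noteq> j" "x \<in> (B(s := C)) i" "y \<in> (B(s := C)) j"
      then show "{x, y} \<in> E"
        using B(3)[of i j x y] CE[of i x y] CE'[of j y x] by (auto simp: less_Suc_eq split: if_splits)
    qed
  qed simp
  from this[of r] obtain B where "\<forall>i<r. B i \<subseteq> A i \<and> card (B i) = t"
    "\<forall>i<r. \<forall>j<r. i \<noteq> j \<longrightarrow> (\<forall>x\<in>B i. \<forall>y\<in>B j. {x, y} \<in> E)"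
    by auto
  then show ?thesis by (intro that[of B]) simp_all
qed

section \<open>Copies of a Turan graph with one added edge\<close>

definition add_edge :: "'a graph \<Rightarrow> 'a set \<Rightarrow> 'a graph" where
  "add_edge G e = (verts G, insert e (edges G))"

lemma verts_add_edge [simp]: "verts (add_edge G e) = verts G"
  and edges_add_edge [simp]: "edges (add_edge G e) = insert e (edges G)"
  by (simp_all add: add_edge_def)

text \<open>Send \<open>a\<close> and \<open>b\<close> to \<open>u\<close> and \<open>v\<close>, the
  rest of their class into \<open>B i0\<close>, and the other classes into the other sets. Each set
  has at least \<open>n\<close> vertices, so every class fits. Only \<open>B i0\<close> has to avoid
  \<open>u\<close> and \<open>v\<close> by assumption; adjacency keeps them out of the other
  sets.\<close>

lemma embedding_turan_graph_add_edge:
  fixes G :: "'a graph"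
  assumes G: "wf_graph G" and r: "r > 0"
    and ab: "a < n" "b < n" "a mod r = b mod r" "a \<noteq> b"
    and i0: "i0 < r"
    and B: "\<And>i. i < r \<Longrightarrow> B i \<subseteq> verts G" "\<And>i. i < r \<Longrightarrow> card (B i) \<ge> n"
      "\<And>i j x y. i < r \<Longrightarrow> j < r \<Longrightarrow> i \<noteq> j \<Longrightarrow> x \<in> B i \<Longrightarrow> y \<in> B j \<Longrightarrow> {x, y} \<in> edges G"
    and uv: "{u, v} \<in> edges G" "u \<notin> B i0" "v \<notin> B i0"
      "\<And>j x. j < r \<Longrightarrow> j \<noteq> i0 \<Longrightarrow> x \<in> B j \<Longrightarrow> {u, x} \<in> edges G \<and> {v, x} \<in> edges G"
  shows "\<exists>g. embedding g (add_edge (turan_graph n r) {a, b}) G"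
proof -
  define p where "p = a mod r"
  \<comment> \<open>The transposition of \<open>p\<close> and \<open>i0\<close> assigns the class of
    \<open>a\<close> and \<open>b\<close> to the set \<open>B i0\<close> and permutes the remaining
    classes accordingly.\<close>
  define \<pi> where "\<pi> j = (if j = p then i0 else if j = i0 then p else j)" for j
  have "p < r" using r by (simp add: p_def)
  then have \<pi>_less: "\<pi> j < r" if "j < r" for j using that i0 by (simp add: \<pi>_def)
  have \<pi>_inj: "\<pi> j = \<pi> k \<longleftrightarrow> j = k" for j k by (auto simp: \<pi>_def)
  have \<pi>_i0: "\<pi> j = i0 \<longleftrightarrow> j = p" for j by (auto simp: \<pi>_def)
  have "\<exists>f. f ` {0..<n} \<subseteq> B i \<and> inj_on f {0..<n}" if "i < r" for i
    using B[OF that] finite_subset[OF B(1)[OF that] wf_graph_finite[OF G]]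
    by (intro card_le_inj) auto
  then obtain \<beta> where \<beta>: "\<And>i. i < r \<Longrightarrow> inj_on (\<beta> i) {0..<n}" "\<And>i x. i < r \<Longrightarrow> x < n \<Longrightarrow> \<beta> i x \<in> B i"
  proof -
    from \<open>\<And>i. i < r \<Longrightarrow> \<exists>f. f ` {0..<n} \<subseteq> B i \<and> inj_on f {0..<n}\<close>
    have "\<forall>i. \<exists>f. i < r \<longrightarrow> f ` {0..<n} \<subseteq> B i \<and> inj_on f {0..<n}" by blast
    from choice[OF this] obtain \<beta> where "\<forall>i. i < r \<longrightarrow> \<beta> i ` {0..<n} \<subseteq> B i \<and> inj_on (\<beta> i) {0..<n}" ..
    then show thesis by (intro that[of \<beta>]) (auto simp: image_subset_iff)
  qed
  define g where "g x = (if x = a then u else if x = b then v else \<beta> (\<pi> (x mod r)) x)" for x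
  have mod_less: "x mod r < r" for x using r by simp
  have gB: "g x \<in> B (\<pi> (x mod r))" if "x < n" "x \<noteq> a" "x \<noteq> b" for x
    using that \<beta>(2) \<pi>_less mod_less by (simp add: g_def)
  have ga: "g a = u" "g b = v" using ab by (auto simp: g_def)
  have cross: "{g x, g y} \<in> edges G" if "x < n" "y < n" "x mod r \<noteq> y mod r" for x y
  proof -
    have ux: "{g c, g z} \<in> edges G" if "c = a \<or> c = b" "z < n" "z mod r \<noteq> p" for c z
    proof -
      have "z \<noteq> a" "z \<noteq> b" using that ab by (auto simp: p_def)
      then have "g z \<in> B (\<pi> (z mod r))" using gB that by simp
      then show ?thesis using uv(4)[of "\<pi> (z mod r)" "g z"] \<pi>_less mod_less \<pi>_i0 that ga by auto
    qed
    consider "x = a \<or> x = b" | "y = a \<or> y = b" | "x \<noteq> a" "x \<noteq> b" "y \<noteq> a" "y \<noteq> b" by blast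
    then show ?thesis
    proof cases
      case 1 then show ?thesis using ux[of x y] that ab by (auto simp: p_def)
    next
      case 2 then show ?thesis using ux[of y x] that ab by (auto simp: p_def insert_commute)
    next
      case 3
      then show ?thesis
        using B(3)[of "\<pi> (x mod r)" "\<pi> (y mod r)" "g x" "g y"] gB that \<pi>_less mod_less \<pi>_inj by simp
    qed
  qed
  \<comment> \<open>Vertices of different classes have adjacent, hence distinct, images, so only
    pairs within one class need an argument.\<close>
  have "inj_on g {0..<n}"
  proof (rule inj_onI, rule ccontr)
    fix x y assume xy: "x \<in> {0..<n}" "y \<in> {0..<n}" "g x = g y" "x \<noteq> y"
    show False
    proof (cases "x mod r = y mod r")
      case False
      then have "{g x, g y} \<in> edges G" using xy(1,2) by (intro cross) simp_all
      then show False using wf_graph_edgeD(3)[OF G] xy(3) by blast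
    next
      case True
      have uv': "g z \<notin> {u, v}" if "z < n" "z \<noteq> a" "z \<noteq> b" "z mod r = p" for z
        using gB[OF that(1-3)] that(4) uv \<pi>_i0[of p] by auto
      have "u \<noteq> v" using wf_graph_edgeD[OF G uv(1)] by simp
      have "\<not> (x \<in> {a, b} \<and> y \<in> {a, b})"
        using xy(3,4) ga \<open>u \<noteq> v\<close> by auto
      then consider "x \<noteq> a" "x \<noteq> b" "y \<noteq> a" "y \<noteq> b" | "x \<in> {a, b}" "y \<notin> {a, b}" | "y \<in> {a, b}" "x \<notin> {a, b}"
        by blast
      then show False
      proof cases
        case 1
        then have "\<beta> (\<pi> (x mod r)) x = \<beta> (\<pi> (x mod r)) y" using xy True by (simp add: g_def)
        then show False using \<beta>(1)[OF \<pi>_less[OF mod_less[of x]]] xy by (auto dest: inj_onD)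
      next
        case 2
        then show False using uv'[of y] True xy ab ga by (auto simp: p_def)
      next
        case 3
        then show False using uv'[of x] True xy ab ga by (auto simp: p_def)
      qed
    qed
  qed
  moreover have "g x \<in> verts G" if "x < n" for x
  proof (cases "x = a \<or> x = b")
    case True
    then show ?thesis using ga wf_graph_edgeD[OF G uv(1)] by auto
  next
    case False
    then show ?thesis using gB[of x] B(1) \<pi>_less mod_less that by blast
  qed
  moreover have "g ` e \<in> edges G" if "e \<in> edges (turan_graph n r)" for e
    using that cross by (auto simp: turan_graph_def)
  ultimately have "embedding g (add_edge (turan_graph n r) {a, b}) G"
    using uv(1) ga by (auto simp: embedding_def)
  then show ?thesis by blast
qed

section \<open>Embeddings of forests\<close>

lemma wf_cycle_graph:
  assumes "k \<ge> 3"
  shows "wf_graph (cycle_graph k)"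
proof -
  have "card {i, Suc i mod k} = 2" if "i < k" for i
  proof -
    have "i \<noteq> Suc i mod k"
    proof (cases "Suc i = k")
      case True then show ?thesis using assms by auto
    next
      case False then show ?thesis using that by simp
    qed
    then show ?thesis by (simp add: card_insert_if)
  qed
  then show ?thesis using assms by (auto simp: wf_graph_def cycle_graph_def)
qed

definition remove_vertex :: "'a graph \<Rightarrow> 'a \<Rightarrow> 'a graph" where
  "remove_vertex G v = (verts G - {v}, {e \<in> edges G. v \<notin> e})"

lemma verts_remove_vertex [simp]: "verts (remove_vertex G v) = verts G - {v}"
  and edges_remove_vertex [simp]: "edges (remove_vertex G v) = {e \<in> edges G. v \<notin> e}"
  by (simp_all add: remove_vertex_def)

lemma wf_remove_vertex: "wf_graph G \<Longrightarrow> wf_graph (remove_vertex G v)"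
  by (auto simp: wf_graph_def)

lemma forest_remove_vertex:
  assumes "wf_graph H" "forest H"
  shows "forest (remove_vertex H v)"
  unfolding forest_def
proof (intro allI impI)
  fix k :: nat assume k: "3 \<le> k"
  have "\<not> embedding f (cycle_graph k) H" for f
    using assms k wf_cycle_graph[OF k] by (auto simp: forest_def free_iff_no_embedding)
  moreover have "embedding f (cycle_graph k) H" if "embedding f (cycle_graph k) (remove_vertex H v)" for f
    using that by (auto simp: embedding_def)
  ultimately show "free (cycle_graph k) (remove_vertex H v)"
    using wf_cycle_graph[OF k] wf_remove_vertex[OF assms(1)] by (auto simp: free_iff_no_embedding)
qed

text \<open>An end vertex of a longest path is a leaf: a second neighbour of it would extend the path or
  close a cycle.\<close>
lemma forest_has_leaf:
  assumes H: "wf_graph H" and forest: "forest H" and "edges H \<noteq> {}"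
  obtains u v where "neighbours H u = {v}"
proof -
  \<comment> \<open>Length at least 2 guarantees that \<open>xs ! 1\<close>, the prospective only
    neighbour of the end vertex, exists.\<close>
  define path where "path xs \<longleftrightarrow> distinct xs \<and> set xs \<subseteq> verts H \<and> 2 \<le> length xs \<and>
    (\<forall>i. Suc i < length xs \<longrightarrow> {xs ! i, xs ! Suc i} \<in> edges H)" for xs
  from \<open>edges H \<noteq> {}\<close> obtain a b where ab: "{a, b} \<in> edges H" "a \<noteq> b" "a \<in> verts H" "b \<in> verts H"
    using wf_graph_edgeE[OF H] by (metis ex_in_conv)
  then have "path [a, b]" by (auto simp: path_def less_Suc_eq)
  moreover have "length xs < Suc (card (verts H))" if "path xs" for xs
    using that card_mono[of "verts H" "set xs"] wf_graph_finite[OF H]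
    by (simp add: path_def distinct_card less_Suc_eq_le)
  ultimately obtain xs where xs: "path xs" and longest: "\<And>ys. path ys \<Longrightarrow> length ys \<le> length xs"
    using ex_has_greatest_nat[of path "[a, b]" length] by blast
  define x where "x = xs ! 0"
  have x1: "xs ! 1 \<in> neighbours H x"
    using xs by (auto simp: path_def neighbours_def x_def)
  have "w = xs ! 1" if w: "w \<in> neighbours H x" for w
  proof (rule ccontr)
    assume ne: "w \<noteq> xs ! 1"
    have wx: "{w, x} \<in> edges H" "w \<in> verts H" "w \<noteq> x"
      using w wf_graph_edgeD[OF H] by (auto simp: neighbours_def insert_commute)
    show False
    proof (cases "w \<in> set xs")
      case False
      have "{(w # xs) ! i, (w # xs) ! Suc i} \<in> edges H" if "Suc i < length (w # xs)" for i
        using that xs wx by (cases i) (auto simp: path_def x_def)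
      then have "path (w # xs)" using xs wx False by (auto simp: path_def)
      then show False using longest by fastforce
    next
      case True
      then obtain j where j: "j < length xs" "xs ! j = w" by (auto simp: in_set_conv_nth)
      have "j \<noteq> 0" using j(2) wx(3) by (metis x_def)
      moreover have "j \<noteq> 1" using j(2) ne by metis
      ultimately have k: "3 \<le> Suc j" by simp
      have "embedding ((!) xs) (cycle_graph (Suc j)) H"
        unfolding embedding_def
      proof (intro conjI ballI)
        show "inj_on ((!) xs) (verts (cycle_graph (Suc j)))"
          using xs j by (auto simp: path_def cycle_graph_def inj_on_def nth_eq_iff_index_eq)
        show "(!) xs ` verts (cycle_graph (Suc j)) \<subseteq> verts H"
          using xs j by (auto simp: path_def cycle_graph_def subset_eq)
        fix e assume "e \<in> edges (cycle_graph (Suc j))"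
        then obtain i where i: "i < Suc j" "e = {i, Suc i mod Suc j}"
          by (auto simp: cycle_graph_def)
        show "(!) xs ` e \<in> edges H"
        proof (cases "i = j")
          case True
          then show ?thesis using i j wx by (simp add: x_def)
        next
          case False
          then show ?thesis using i j xs by (simp add: path_def)
        qed
      qed
      moreover have "free (cycle_graph (Suc j)) H" using forest k by (simp add: forest_def)
      ultimately show False using free_iff_no_embedding[OF wf_cycle_graph[OF k] H] by blast
    qed
  qed
  with x1 have "neighbours H x = {xs ! 1}" by blast
  then show thesis by (rule that)
qed

section \<open>Extending an embedding by one vertex\<close>

definition extension_vertices :: "'a graph \<Rightarrow> 'b graph \<Rightarrow> 'a \<Rightarrow> ('a \<Rightarrow> 'b) \<Rightarrow> 'b set" where
  "extension_vertices H G v g = {x \<in> verts G. x \<notin> g ` (verts H - {v}) \<and> (\<forall>w\<in>neighbours H v. {x, g w} \<in> edges G)}"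

lemma embedding_fun_upd_iff:
  assumes H: "wf_graph H" and v: "v \<in> verts H"
  shows "embedding (g(v := x)) H G \<longleftrightarrow>
    embedding g (remove_vertex H v) G \<and> x \<in> extension_vertices H G v g"
proof -
  have E: "(\<forall>e\<in>edges H. (g(v := x)) ` e \<in> edges G) \<longleftrightarrow>
      (\<forall>e\<in>edges H. v \<notin> e \<longrightarrow> g ` e \<in> edges G) \<and> (\<forall>w\<in>neighbours H v. {x, g w} \<in> edges G)"
  proof -
    have *: "(\<forall>e\<in>edges H. v \<in> e \<longrightarrow> (g(v := x)) ` e \<in> edges G) \<longleftrightarrow> (\<forall>w\<in>neighbours H v. {x, g w} \<in> edges G)"
    proof (intro iffI ballI impI)
      fix w assume a: "\<forall>e\<in>edges H. v \<in> e \<longrightarrow> (g(v := x)) ` e \<in> edges G" and w: "w \<in> neighbours H v"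
      then have vw: "{v, w} \<in> edges H" by (simp add: neighbours_def)
      moreover have "w \<noteq> v" using wf_graph_edgeD(3)[OF H vw] by simp
      ultimately
      show "{x, g w} \<in> edges G" using bspec[OF a, of "{v, w}"] by (simp add: insert_commute)
    next
      fix e assume a: "\<forall>w\<in>neighbours H v. {x, g w} \<in> edges G" and e: "e \<in> edges H" "v \<in> e"
      obtain c d where cd: "e = {c, d}" "c \<noteq> d" using wf_graph_edgeE[OF H e(1)] by blast
      then obtain w where w: "e = {v, w}" "w \<noteq> v" using e(2) by blast
      then have "w \<in> neighbours H v" using e by (simp add: neighbours_def)
      then show "(g(v := x)) ` e \<in> edges G" using a w by (simp add: insert_commute)
    qed
    have "(g(v := x)) ` e = g ` e" if "v \<notin> e" for e using that by (auto simp: image_def)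
    then show ?thesis using * by metis
  qed
  have V: "inj_on (g(v := x)) (verts H) \<longleftrightarrow> inj_on g (verts H - {v}) \<and> x \<notin> g ` (verts H - {v})"
  proof -
    have "inj_on (g(v := x)) (insert v (verts H - {v})) \<longleftrightarrow>
      inj_on (g(v := x)) (verts H - {v}) \<and> x \<notin> g ` (verts H - {v})"
      by (subst inj_on_insert) auto
    moreover have "inj_on (g(v := x)) (verts H - {v}) \<longleftrightarrow> inj_on g (verts H - {v})"
      by (intro inj_on_cong) auto
    ultimately show ?thesis using v by (simp add: insert_absorb)
  qed
  have I: "(g(v := x)) ` verts H \<subseteq> verts G \<longleftrightarrow> g ` (verts H - {v}) \<subseteq> verts G \<and> x \<in> verts G"
    using v by (auto simp: image_subset_iff)
  show ?thesis
    unfolding embedding_def E V I extension_vertices_def by auto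
qed

text \<open>The embeddings of \<open>H\<close> are fibred over their restrictions to
  \<open>verts H - {v}\<close>; within a fibre only the image of \<open>v\<close> varies.\<close>

lemma card_embeddings_remove_vertex:
  assumes H: "wf_graph H" and G: "wf_graph G" and v: "v \<in> verts H"
  shows "card (embeddings H G) =
    (\<Sum>g\<in>embeddings (remove_vertex H v) G. card (extension_vertices H G v g))"
proof -
  let ?H' = "remove_vertex H v"
  let ?E = "embeddings ?H' G"
  let ?S = "Sigma ?E (extension_vertices H G v)"
  have "bij_betw (\<lambda>(g, x). g(v := x)) ?S (embeddings H G)"
  proof (rule bij_betw_byWitness[where f' = "\<lambda>f. (restrict f (verts H - {v}), f v)"])
    show "\<forall>a\<in>?S. (\<lambda>f. (restrict f (verts H - {v}), f v)) ((\<lambda>(g, x). g(v := x)) a) = a"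
      by (auto simp: embeddings_def extensional_def restrict_def fun_eq_iff)
    show "\<forall>f\<in>embeddings H G. (\<lambda>(g, x). g(v := x)) (restrict f (verts H - {v}), f v) = f"
      using v by (auto simp: embeddings_def extensional_def restrict_def fun_eq_iff)
    show "(\<lambda>(g, x). g(v := x)) ` ?S \<subseteq> embeddings H G"
      using v by (auto simp: embeddings_def embedding_fun_upd_iff[OF H v] extensional_def)
    show "(\<lambda>f. (restrict f (verts H - {v}), f v)) ` embeddings H G \<subseteq> ?S"
    proof (intro image_subsetI)
      fix f assume f: "f \<in> embeddings H G"
      define g where "g = restrict f (verts H - {v})"
      have eq: "g(v := f v) = f"
        using f v by (auto simp: g_def embeddings_def extensional_def restrict_def fun_eq_iff)
      have "embedding (g(v := f v)) H G" unfolding eq using f by (simp add: embeddings_def)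
      from iffD1[OF embedding_fun_upd_iff[OF H v] this]
      have "embedding g ?H' G" "f v \<in> extension_vertices H G v g" by simp_all
      then have "g \<in> ?E" "f v \<in> extension_vertices H G v g"
        by (simp_all add: embeddings_def g_def)
      then show "(restrict f (verts H - {v}), f v) \<in> ?S" by (simp add: g_def)
    qed
  qed
  then have "card (embeddings H G) = card ?S" by (simp add: bij_betw_same_card)
  also have "\<dots> = (\<Sum>g\<in>?E. card (extension_vertices H G v g))"
    using finite_embeddings[OF wf_remove_vertex[OF H] G] wf_graph_finite[OF G]
    by (intro card_SigmaI) (auto simp: extension_vertices_def)
  finally show ?thesis .
qed

lemma extension_vertices_isolated:
  assumes "neighbours H v = {}"
  shows "extension_vertices H G v g = verts G - g ` (verts H - {v})"
  using assms by (auto simp: extension_vertices_def)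

lemma extension_vertices_leaf:
  assumes "wf_graph G" "neighbours H v = {w}"
  shows "extension_vertices H G v g = neighbours G (g w) - g ` (verts H - {v})"
  using assms wf_graph_edgeD[OF assms(1)]
  by (auto simp: extension_vertices_def neighbours_def insert_commute)

text \<open>Embedding a forest vertex by vertex, each new vertex has at most one embedded neighbour, so the
  number of choices is governed by vertex degrees alone. The factor n avoids the truncated exponent
  of a vertexless forest.\<close>
lemma card_embeddings_forest_le:
  assumes "wf_graph H" "forest H"
  shows "\<exists>C. \<forall>n D (G :: 'b graph) (T :: 'c graph). wf_graph G \<and> wf_graph T \<and>
     card (verts G) = n \<and> card (verts T) = n \<and> n > 0 \<and> D \<le> n \<and>
     (\<forall>v\<in>verts G. D \<le> card (neighbours G v)) \<and> (\<forall>v\<in>verts T. card (neighbours T v) \<le> D + 3) \<longrightarrow>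
     n * card (embeddings H T) \<le> n * card (embeddings H G) + C * n ^ card (verts H)"
  using assms
proof (induction "card (verts H)" arbitrary: H)
  case 0
  then have "verts H = {}" using wf_graph_finite by fastforce
  moreover from this have "edges H = {}"
    using wf_graph_edgeE[OF 0(2)] by blast
  ultimately have "embeddings H G = {\<lambda>_. undefined}" for G :: "'b graph"
    using \<open>verts H = {}\<close> \<open>edges H = {}\<close> by (auto simp: embeddings_def embedding_def)
  moreover have "embeddings H T = {\<lambda>_. undefined}" for T :: "'c graph"
    using \<open>verts H = {}\<close> \<open>edges H = {}\<close> by (auto simp: embeddings_def embedding_def)
  ultimately show ?case by (intro exI[of _ 0]) simp
next
  case (Suc k)
  have "\<exists>v\<in>verts H. neighbours H v = {} \<or> (\<exists>w. neighbours H v = {w})"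
  proof (cases "edges H = {}")
    case True
    have "verts H \<noteq> {}" using Suc.hyps(2) by auto
    then show ?thesis using True by (auto simp: neighbours_def)
  next
    case False
    then obtain u w where uw: "neighbours H u = {w}" using forest_has_leaf Suc.prems by metis
    then have "{u, w} \<in> edges H" by (auto simp: neighbours_def)
    then have "u \<in> verts H" using wf_graph_edgeD Suc.prems by metis
    then show ?thesis using uw by blast
  qed
  then obtain v where v: "v \<in> verts H" "neighbours H v = {} \<or> (\<exists>w. neighbours H v = {w})" by blast
  let ?H = "remove_vertex H v"
  have k: "card (verts ?H) = k" using Suc.hyps(2) v Suc.prems by (simp add: wf_graph_finite)
  have wfH: "wf_graph ?H" "forest ?H"
    using Suc.prems by (simp_all add: wf_remove_vertex forest_remove_vertex)
  from Suc.hyps(1)[OF k[symmetric] wfH] obtain C where C: "\<And>n D (G :: 'b graph) (T :: 'c graph).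
     \<lbrakk>wf_graph G; wf_graph T; card (verts G) = n; card (verts T) = n; n > 0; D \<le> n;
     (\<forall>v\<in>verts G. D \<le> card (neighbours G v)); (\<forall>v\<in>verts T. card (neighbours T v) \<le> D + 3)\<rbrakk> \<Longrightarrow>
     n * card (embeddings ?H T) \<le> n * card (embeddings ?H G) + C * n ^ k"
    unfolding k by blast
  show ?case
  \<comment> \<open>The inherited error \<open>C * n ^ k\<close> is multiplied by a number of
    choices that is at most \<open>n + 3\<close>, hence at most \<open>4 * n\<close>. The new vertex
    adds \<open>k\<close> for the images already occupied and 3 for the gap between the degree
    bounds.\<close>
  proof (intro exI[of _ "4 * C + k + 3"] allI impI, elim conjE)
    fix n D :: nat and G :: "'b graph" and T :: "'c graph"
    assume G: "wf_graph G" and T: "wf_graph T" and cG: "card (verts G) = n" and cT: "card (verts T) = n"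
      and n: "n > 0" and D: "D \<le> n" and dG: "\<forall>v\<in>verts G. D \<le> card (neighbours G v)"
      and dT: "\<forall>v\<in>verts T. card (neighbours T v) \<le> D + 3"
    \<comment> \<open>A common yardstick for both graphs: \<open>x\<close> bounds the choices in
      \<open>T\<close> from above and, up to \<open>k + 3\<close>, those in \<open>G\<close> from
      below. It is \<open>n\<close> for an isolated vertex and \<open>D + 3\<close> for a
      leaf.\<close>
    have "\<exists>x. x \<le> n + 3 \<and> (\<forall>g\<in>embeddings ?H T. card (extension_vertices H T v g) \<le> x) \<and>
        (\<forall>g\<in>embeddings ?H G. x \<le> card (extension_vertices H G v g) + (k + 3))"
    proof -
      have img: "card (g ` (verts H - {v})) \<le> k" for g :: "'a \<Rightarrow> 'b"
        using k card_image_le[of "verts H - {v}" g] wf_graph_finite[OF Suc.prems(1)] by simp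
      have diff: "card A \<le> card (A - g ` (verts H - {v})) + k" if "finite A" for A and g :: "'a \<Rightarrow> 'b"
        using diff_card_le_card_Diff[of "g ` (verts H - {v})" A] img[of g] wf_graph_finite[OF Suc.prems(1)]
        by simp
      consider "neighbours H v = {}" | w where "neighbours H v = {w}" using v by blast
      then show ?thesis
      proof cases
        case 1
        have "card (extension_vertices H T v g) \<le> n" for g
          unfolding extension_vertices_isolated[OF 1] cT[symmetric]
          by (intro card_mono) (auto simp: wf_graph_finite T)
        moreover have "n \<le> card (extension_vertices H G v g) + (k + 3)" for g
          unfolding extension_vertices_isolated[OF 1] using diff[OF wf_graph_finite[OF G], of g] cG by simp
        ultimately show ?thesis by (intro exI[of _ n]) simp
      next
        case 2
        have w: "w \<in> verts H - {v}"
          using 2 neighbours_subset[OF Suc.prems(1), of v] by auto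
        have "card (extension_vertices H T v g) \<le> D + 3" if "g \<in> embeddings ?H T" for g
        proof -
          have "g w \<in> verts T" using that w by (auto simp: embeddings_def embedding_def)
          then have "card (neighbours T (g w)) \<le> D + 3" using dT by blast
          moreover have "card (extension_vertices H T v g) \<le> card (neighbours T (g w))"
            unfolding extension_vertices_leaf[OF T 2] by (intro card_mono) (auto simp: finite_neighbours T)
          ultimately show ?thesis by simp
        qed
        moreover have "D + 3 \<le> card (extension_vertices H G v g) + (k + 3)" if "g \<in> embeddings ?H G" for g
        proof -
          have "g w \<in> verts G" using that w by (auto simp: embeddings_def embedding_def)
          then have "D \<le> card (neighbours G (g w))" using dG by blast
          then show ?thesis
            unfolding extension_vertices_leaf[OF G 2] using diff[OF finite_neighbours[OF G], of "g w" g] by simp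
        qed
        ultimately show ?thesis using D by (intro exI[of _ "D + 3"]) simp
      qed
    qed
    then obtain x where x: "x \<le> n + 3" "\<And>g. g \<in> embeddings ?H T \<Longrightarrow> card (extension_vertices H T v g) \<le> x"
      "\<And>g. g \<in> embeddings ?H G \<Longrightarrow> x \<le> card (extension_vertices H G v g) + (k + 3)" by blast
    let ?a = "card (embeddings ?H T)" and ?b = "card (embeddings ?H G)"
    have eT: "card (embeddings H T) \<le> ?a * x"
      unfolding card_embeddings_remove_vertex[OF Suc.prems(1) T v(1)]
      using sum_bounded_above[of "embeddings ?H T" _ x] x(2) by simp
    have eG: "?b * x \<le> card (embeddings H G) + ?b * (k + 3)"
    proof -
      have "(\<Sum>g\<in>embeddings ?H G. x) \<le> (\<Sum>g\<in>embeddings ?H G. card (extension_vertices H G v g) + (k + 3))"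
        using x(3) by (rule sum_mono)
      also have "\<dots> = (\<Sum>g\<in>embeddings ?H G. card (extension_vertices H G v g)) + ?b * (k + 3)"
        by (subst sum.distrib) simp
      finally show ?thesis
        unfolding card_embeddings_remove_vertex[OF Suc.prems(1) G v(1)] by simp
    qed
    have b: "?b \<le> n ^ k" using card_embeddings_le[OF wfH(1) G] by (simp only: cG k)
    have IH: "n * ?a \<le> n * ?b + C * n ^ k" using C[OF G T cG cT n D dG dT] .
    have "n * card (embeddings H T) \<le> n * (?a * x)" using eT by (rule mult_le_mono2)
    also have "\<dots> = (n * ?a) * x" by simp
    also have "\<dots> \<le> (n * ?b + C * n ^ k) * x" using IH by (rule mult_le_mono1)
    also have "\<dots> = n * (?b * x) + C * n ^ k * x" by (simp add: algebra_simps)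
    also have "\<dots> \<le> n * (card (embeddings H G) + n ^ k * (k + 3)) + C * n ^ k * (4 * n)"
    proof (intro add_mono mult_le_mono2)
      show "?b * x \<le> card (embeddings H G) + n ^ k * (k + 3)"
        using eG mult_le_mono1[OF b, of "k + 3"] by linarith
      show "x \<le> 4 * n" using x(1) n by simp
    qed
    also have "\<dots> = n * card (embeddings H G) + (4 * C + k + 3) * n ^ Suc k" by (simp add: algebra_simps)
    finally show "n * card (embeddings H T) \<le> n * card (embeddings H G) + (4 * C + k + 3) * n ^ card (verts H)"
      using Suc.hyps(2) by simp
  qed
qed

section \<open>Graphs close to the Turan graph\<close>

text \<open>The colour \<open>q v\<close> is a part in which \<open>v\<close> has fewer than
  \<open>t + d\<close> neighbours; it may differ from \<open>p v\<close>. By the degree bound at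
  most \<open>s + 2\<close> vertices lie outside the neighbourhood of \<open>v\<close>. Nearly
  \<open>s\<close> of these are in part \<open>q v\<close>, so few remain elsewhere, and
  \<open>v\<close> behaves like a member of that part.\<close>

lemma near_turan_colourable:
  fixes p :: "'a \<Rightarrow> nat"
  assumes G: "wf_graph G" and r: "r > 0"
    and ab: "a < n" "b < n" "a mod r = b mod r" "a \<noteq> b"
    and no_emb: "\<And>g. \<not> embedding g (add_edge (turan_graph n r) {a, b}) G"
    and parts: "\<And>i. i < r \<Longrightarrow> s \<le> card {v \<in> verts G. p v = i}"
    and deg: "\<And>v. v \<in> verts G \<Longrightarrow> card (verts G) \<le> card (neighbours G v) + s + 2"
    and bad: "card {v \<in> verts G. d < card {w \<in> verts G. p w \<noteq> p v \<and> {v, w} \<notin> edges G}} \<le> d"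
    and large: "3 * (r * Suc n * d + Suc n + d) + 6 \<le> s"
  shows "\<exists>q. q ` verts G \<subseteq> {..<r} \<and> (\<forall>u v. {u, v} \<in> edges G \<longrightarrow> q u \<noteq> q v)"
proof -
  let ?V = "verts G" and ?E = "edges G" and ?N = "neighbours G"
  define P where "P i = {v \<in> ?V. p v = i}" for i
  define Bad where "Bad = {v \<in> ?V. d < card {w \<in> ?V. p w \<noteq> p v \<and> {v, w} \<notin> ?E}}"
  \<comment> \<open>The size from which the greedy choice extracts sets of \<open>Suc n\<close>
    vertices. The one vertex beyond \<open>n\<close> can be spent as an end of the added
    edge.\<close>
  define t where "t = r * Suc n * d + Suc n"
  have finV: "finite ?V" using G by (rule wf_graph_finite)
  have finBad: "finite Bad" "card Bad \<le> d" using finV bad by (auto simp: Bad_def)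
  have finP: "finite (P i)" for i using finV by (simp add: P_def)
  \<comment> \<open>A vertex outside \<open>Bad\<close> misses at most \<open>d\<close> vertices of
    the other parts, which is the hypothesis of the greedy choice.\<close>
  have rich: "\<exists>B. (\<forall>i<r. B i \<subseteq> A i \<and> card (B i) = Suc n) \<and>
      (\<forall>i<r. \<forall>j<r. i \<noteq> j \<longrightarrow> (\<forall>x\<in>B i. \<forall>y\<in>B j. {x, y} \<in> ?E))"
    if A: "\<And>i. i < r \<Longrightarrow> A i \<subseteq> P i - Bad" "\<And>i. i < r \<Longrightarrow> t \<le> card (A i)" for A
  proof -
    have miss: "card {y \<in> A j. {x, y} \<notin> ?E} \<le> d" if "i < r" "j < r" "i \<noteq> j" "x \<in> A i" for i j x
    proof -
      have x: "x \<in> ?V" "p x = i" "x \<notin> Bad" using A(1)[OF that(1)] that(4) by (auto simp: P_def)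
      have "{y \<in> A j. {x, y} \<notin> ?E} \<subseteq> {w \<in> ?V. p w \<noteq> p x \<and> {x, w} \<notin> ?E}"
        using A(1)[OF that(2)] x that(3) by (auto simp: P_def)
      then have "card {y \<in> A j. {x, y} \<notin> ?E} \<le> card {w \<in> ?V. p w \<noteq> p x \<and> {x, w} \<notin> ?E}"
        using finV by (intro card_mono) auto
      also have "\<dots> \<le> d" using x by (simp add: Bad_def)
      finally show ?thesis .
    qed
    have fin: "finite (A i)" if "i < r" for i
      using A(1)[OF that] finP by (meson finite_Diff finite_subset)
    have size: "r * Suc n * d + Suc n \<le> card (A i)" if "i < r" for i
      using A(2)[OF that] by (simp only: t_def)
    show ?thesis
    proof (rule ex_complete_partite_subset[OF fin size miss])
      fix B assume "\<And>i. i < r \<Longrightarrow> B i \<subseteq> A i" "\<And>i. i < r \<Longrightarrow> card (B i) = Suc n"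
        "\<And>i j x y. i < r \<Longrightarrow> j < r \<Longrightarrow> i \<noteq> j \<Longrightarrow> x \<in> B i \<Longrightarrow> y \<in> B j \<Longrightarrow> {x, y} \<in> ?E"
      then show ?thesis by (intro exI[of _ B]) simp
    qed
  qed
  \<comment> \<open>Otherwise \<open>v\<close> keeps \<open>t\<close> neighbours in every part after
    \<open>Bad\<close> is discarded, so its neighbourhood contains a complete r-partite graph. The
    added edge is then realized by \<open>v\<close> and a vertex \<open>u\<close> of
    \<open>B 0\<close>, with \<open>v\<close> playing a vertex of part 0 wherever it actually
    lies.\<close>
  have "\<exists>i<r. card (?N v \<inter> P i) < t + d" if v: "v \<in> ?V" for v
  proof (rule ccontr)
    assume "\<not> ?thesis"
    then have many: "t + d \<le> card (?N v \<inter> P i)" if "i < r" for i using that by (meson not_le)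
    have "t \<le> card (?N v \<inter> P i - Bad)" if "i < r" for i
      using many[OF that] finBad diff_card_le_card_Diff[OF finBad(1), of "?N v \<inter> P i"] by linarith
    moreover have "?N v \<inter> P i - Bad \<subseteq> P i - Bad" for i by blast
    ultimately have "\<exists>B. (\<forall>i<r. B i \<subseteq> ?N v \<inter> P i - Bad \<and> card (B i) = Suc n) \<and>
      (\<forall>i<r. \<forall>j<r. i \<noteq> j \<longrightarrow> (\<forall>x\<in>B i. \<forall>y\<in>B j. {x, y} \<in> ?E))"
      by (intro rich)
    then obtain B where B: "\<forall>i<r. B i \<subseteq> ?N v \<inter> P i - Bad \<and> card (B i) = Suc n"
      "\<forall>i<r. \<forall>j<r. i \<noteq> j \<longrightarrow> (\<forall>x\<in>B i. \<forall>y\<in>B j. {x, y} \<in> ?E)"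
      by (elim exE conjE)
    have "card (B 0) = Suc n" using B(1) r by blast
    then obtain u where u: "u \<in> B 0" by fastforce
    have BN: "x \<in> ?N v" "x \<in> ?V" if "i < r" "x \<in> B i" for i x
      using B(1) that by (auto simp: P_def)
    define B' where "B' = B(0 := B 0 - {u})"
    have sub: "B' i \<subseteq> B i" for i by (auto simp: B'_def)
    have "\<exists>g. embedding g (add_edge (turan_graph n r) {a, b}) G"
    proof (rule embedding_turan_graph_add_edge[OF G r ab, where ?i0.0 = 0 and B = B' and u = v and v = u])
      show "0 < r" by (rule r)
      show "B' i \<subseteq> ?V" if "i < r" for i using BN(2)[OF that] sub by blast
      show "n \<le> card (B' i)" if "i < r" for i
        using B(1) that u by (auto simp: B'_def card_Diff_singleton)
      show "{x, y} \<in> ?E" if "i < r" "j < r" "i \<noteq> j" "x \<in> B' i" "y \<in> B' j" for i j x y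
        using B(2) that sub by blast
      show "{v, u} \<in> ?E" using BN(1)[OF r u] by (simp add: neighbours_def)
      show "v \<notin> B' 0"
        using BN(1)[OF r, of v] sub neighbours_subset[OF G, of v] by blast
      show "u \<notin> B' 0" by (simp add: B'_def)
      show "{v, x} \<in> ?E \<and> {u, x} \<in> ?E" if "j < r" "j \<noteq> 0" "x \<in> B' j" for j x
      proof
        have x: "x \<in> B j" using that sub by blast
        show "{v, x} \<in> ?E" using BN(1)[OF that(1) x] by (simp add: neighbours_def)
        show "{u, x} \<in> ?E" using B(2) r that(1,2) u x by blast
      qed
    qed
    then show False using no_emb by blast
  qed
  then have "\<forall>v\<in>?V. \<exists>i. i < r \<and> card (?N v \<inter> P i) < t + d" by simp
  from bchoice[OF this] obtain q where "\<forall>v\<in>?V. q v < r \<and> card (?N v \<inter> P (q v)) < t + d" ..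
  then have q: "\<And>v. v \<in> ?V \<Longrightarrow> q v < r" "\<And>v. v \<in> ?V \<Longrightarrow> card (?N v \<inter> P (q v)) < t + d"
    by simp_all
  define X where "X v = {w \<in> ?V. p w \<noteq> q v \<and> w \<notin> ?N v}" for v
  have cardX: "card (X v) \<le> t + d + 2" if v: "v \<in> ?V" for v
  proof -
    have "card (X v) + card (P (q v) - ?N v) = card (X v \<union> (P (q v) - ?N v))"
      using finV by (intro card_Un_disjoint[symmetric]) (auto simp: X_def P_def)
    also have "\<dots> \<le> card (?V - ?N v)"
      using finV by (intro card_mono) (auto simp: X_def P_def)
    also have "\<dots> = card ?V - card (?N v)"
      using neighbours_subset[OF G, of v] finite_neighbours[OF G] by (intro card_Diff_subset) auto
    finally have "card (X v) + card (P (q v) - ?N v) \<le> s + 2" using deg[OF v] by linarith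
    moreover have "s \<le> card (P (q v) - ?N v) + card (?N v \<inter> P (q v))"
    proof -
      have "card (P (q v)) = card (P (q v) - ?N v) + card (?N v \<inter> P (q v))"
        using finP by (subst card_Un_disjoint[symmetric]) (auto intro!: arg_cong[of _ _ card])
      then show ?thesis using parts[OF q(1)[OF v]] by (simp add: P_def)
    qed
    ultimately show ?thesis using q(2)[OF v] by linarith
  qed
  have "q u \<noteq> q v" if uv: "{u, v} \<in> ?E" for u v
  proof
    assume quv: "q u = q v"
    have V: "u \<in> ?V" "v \<in> ?V" using wf_graph_edgeD[OF G uv] by auto
    \<comment> \<open>Outside \<open>Z\<close>, every part other than \<open>q u\<close> consists of
      common neighbours of \<open>u\<close> and \<open>v\<close>. Since \<open>Z\<close> has at most
      \<open>2 * t + 3 * d + 6\<close> vertices and \<open>large\<close> says that \<open>s\<close>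
      is at least \<open>3 * (t + d) + 6\<close>, each part keeps at least \<open>t\<close>
      vertices.\<close>
    define Z where "Z = Bad \<union> {u, v} \<union> X u \<union> X v"
    have finZ: "finite Z" using finBad finV by (simp add: Z_def X_def)
    have "card Z \<le> card Bad + card {u, v} + card (X u) + card (X v)"
      unfolding Z_def by (meson add_le_mono1 card_Un_le order_trans)
    then have cardZ: "card Z \<le> d + 2 + 2 * (t + d + 2)"
      using finBad(2) cardX[OF V(1)] cardX[OF V(2)] card_insert_le_m1[of 2 "{v}" u] by simp
    have "t \<le> card (P i - Z)" if "i < r" for i
      using diff_card_le_card_Diff[OF finZ, of "P i"] parts[OF that] cardZ large
      by (simp add: P_def t_def)
    moreover have "P i - Z \<subseteq> P i - Bad" for i by (auto simp: Z_def)
    ultimately have "\<exists>B. (\<forall>i<r. B i \<subseteq> P i - Z \<and> card (B i) = Suc n) \<and>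
      (\<forall>i<r. \<forall>j<r. i \<noteq> j \<longrightarrow> (\<forall>x\<in>B i. \<forall>y\<in>B j. {x, y} \<in> ?E))"
      by (intro rich)
    then obtain B where B: "\<forall>i<r. B i \<subseteq> P i - Z \<and> card (B i) = Suc n"
      "\<forall>i<r. \<forall>j<r. i \<noteq> j \<longrightarrow> (\<forall>x\<in>B i. \<forall>y\<in>B j. {x, y} \<in> ?E)"
      by (elim exE conjE)
    have "\<exists>g. embedding g (add_edge (turan_graph n r) {a, b}) G"
    proof (rule embedding_turan_graph_add_edge[OF G r ab, where ?i0.0 = "q u" and B = B and u = u and v = v])
      show "q u < r" using q(1)[OF V(1)] .
      show "B i \<subseteq> ?V" if "i < r" for i using B(1) that by (auto simp: P_def)
      show "n \<le> card (B i)" if "i < r" for i using B(1) that by simp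
      show "{x, y} \<in> ?E" if "i < r" "j < r" "i \<noteq> j" "x \<in> B i" "y \<in> B j" for i j x y
        using B(2) that by blast
      show "{u, v} \<in> ?E" by (rule uv)
      show "u \<notin> B (q u)" "v \<notin> B (q u)" using B(1) q(1)[OF V(1)] by (auto simp: Z_def)
      show "{u, x} \<in> ?E \<and> {v, x} \<in> ?E" if "j < r" "j \<noteq> q u" "x \<in> B j" for j x
      proof -
        have "x \<in> P j - Z" using B(1) that by blast
        then have "x \<in> ?V" "p x \<noteq> q u" "p x \<noteq> q v" "x \<notin> X u" "x \<notin> X v"
          using that(2) quv by (auto simp: P_def Z_def)
        then show ?thesis by (simp add: X_def neighbours_def)
      qed
    qed
    then show False using no_emb by blast
  qed
  then show ?thesis using q(1) by blast
qed

section \<open>Dense subgraphs\<close>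

lemma edges_within_eq: "wf_graph G \<Longrightarrow> {e \<in> edges G. e \<subseteq> verts G} = edges G"
  using wf_graph_edge_subset by blast

lemma card_edges_within_le:
  assumes "finite U" "\<forall>e\<in>E. card e = 2"
  shows "card {e \<in> E. e \<subseteq> U} \<le> card U * card U"
proof -
  have "{e \<in> E. e \<subseteq> U} \<subseteq> (\<lambda>(x, y). {x, y}) ` (U \<times> U)"
  proof
    fix e assume e: "e \<in> {e \<in> E. e \<subseteq> U}"
    then obtain x y where "e = {x, y}" using assms(2) by (auto simp: card_2_iff)
    then show "e \<in> (\<lambda>(x, y). {x, y}) ` (U \<times> U)" using e by (intro image_eqI[of _ _ "(x, y)"]) auto
  qed
  then have "card {e \<in> E. e \<subseteq> U} \<le> card (U \<times> U)"
    using assms(1) by (meson card_image_le card_mono finite_SigmaI finite_imageI order_trans)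
  then show ?thesis by (simp add: card_cartesian_product)
qed

text \<open>Take a vertex set U maximizing e(U) - e(T(|U|, r)) + |U|: the last summand forces U to be large,
  and deleting a vertex of U shows that its degree is nearly that of the Turan graph.\<close>
lemma ex_dense_vertex_set:
  assumes G: "wf_graph G" and cV: "card (verts G) = n"
    and many: "card (edges (turan_graph n r)) < card (edges G)" and n: "M * M + M \<le> n"
  obtains U where "U \<subseteq> verts G" "M \<le> card U"
    "card (edges (turan_graph (card U) r)) < card {e \<in> edges G. e \<subseteq> U}"
    "\<And>v. v \<in> U \<Longrightarrow> card U \<le> card {w \<in> U. {v, w} \<in> edges G} + card U div r + 2"
proof -
  let ?V = "verts G" and ?E = "edges G"
  define t where "t m = int (card (edges (turan_graph m r)))" for m
  define f where "f U = int (card {e \<in> ?E. e \<subseteq> U}) - t (card U) + int (card U)" for U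
  have finV: "finite ?V" using G by (rule wf_graph_finite)
  have finE: "finite ?E" "\<forall>e\<in>?E. card e = 2"
    using wf_graph_finite_edges[OF G] wf_graph_edge_card[OF G] by auto
  have fin: "finite (f ` Pow ?V)" using finV by simp
  then have "Max (f ` Pow ?V) \<in> f ` Pow ?V" by (rule Max_in) auto
  then obtain U where U: "U \<subseteq> ?V" "f U = Max (f ` Pow ?V)" by auto
  have max: "f W \<le> f U" if "W \<subseteq> ?V" for W
    unfolding U(2) using that fin by (intro Max_ge) auto
  have finU: "finite U" using U(1) finV by (rule finite_subset)
  have "int n + 1 \<le> f ?V"
    using many by (simp add: f_def t_def edges_within_eq[OF G] cV)
  then have fU: "int n + 1 \<le> f U" using max[of ?V] by simp
  have cU: "card U \<le> n" using card_mono[OF finV U(1)] cV by simp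
  have "M \<le> card U"
  proof (rule ccontr)
    assume "\<not> M \<le> card U"
    then have "card U * card U + card U \<le> M * M + M" by (intro add_mono mult_mono) auto
    moreover have "f U \<le> int (card U * card U + card U)"
      unfolding f_def t_def using card_edges_within_le[OF finU finE(2)] by linarith
    ultimately show False using n fU by linarith
  qed
  \<comment> \<open>The maximum is at least \<open>n + 1\<close>, while the bonus
    \<open>card U\<close> contributes at most \<open>n\<close>, so the surplus of edges over the
    Turan graph stays positive.\<close>
  moreover have "card (edges (turan_graph (card U) r)) < card {e \<in> ?E. e \<subseteq> U}"
    using fU cU by (simp add: f_def t_def)
  \<comment> \<open>The defect 2 has two sources: the bonus of 1 lost with \<open>v\<close>, and the
    step from \<open>m\<close> to \<open>card U = Suc m\<close>.\<close>
  moreover have "card U \<le> card {w \<in> U. {v, w} \<in> ?E} + card U div r + 2" if v: "v \<in> U" for v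
  proof -
    obtain m where m: "card U = Suc m" using v finU by (metis card_Suc_Diff1)
    have cm: "card (U - {v}) = m" using v finU m by (simp add: card_Diff_singleton)
    have "U - {v} \<subseteq> ?V" using U(1) by blast
    then have "f (U - {v}) \<le> f U" by (rule max)
    then have "t (Suc m) \<le> t m + int (card {w \<in> U. {v, w} \<in> ?E}) + 1"
      using card_edges_within_remove[OF finE(1) v finE(2)] by (simp add: f_def cm m)
    moreover have "t m + int m \<le> t (Suc m) + int (m div r)"
      unfolding t_def using card_edges_turan_graph_Suc[of m r] by linarith
    moreover have "m div r \<le> card U div r" unfolding m by (intro div_le_mono) simp
    ultimately show ?thesis unfolding m by linarith
  qed
  ultimately show ?thesis using U(1) by (intro that[of U])
qed

text \<open>The dense vertex set is renamed to \<open>{0..<m}\<close>, because stability and the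
  extremal numbers speak of \<open>graphs_on m\<close>. The embedding \<open>h\<close> lets the
  subgraph inherit freeness from \<open>G\<close>.\<close>

lemma ex_dense_subgraph:
  assumes G: "wf_graph (G :: 'a graph)" and cV: "card (verts G) = n"
    and many: "card (edges (turan_graph n r)) < card (edges G)" and n: "M * M + M \<le> n"
  obtains m K h where "M \<le> m" "K \<in> graphs_on m" "embedding h K G"
    "card (edges (turan_graph m r)) < card (edges K)"
    "\<And>v. v \<in> verts K \<Longrightarrow> m \<le> card (neighbours K v) + m div r + 2"
proof -
  obtain U where U: "U \<subseteq> verts G" "M \<le> card U"
    "card (edges (turan_graph (card U) r)) < card {e \<in> edges G. e \<subseteq> U}"
    "\<And>v. v \<in> U \<Longrightarrow> card U \<le> card {w \<in> U. {v, w} \<in> edges G} + card U div r + 2"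
    using ex_dense_vertex_set[OF G cV many n] by blast
  define m where "m = card U"
  have "finite U" using U(1) wf_graph_finite[OF G] by (rule finite_subset)
  then obtain h where h: "bij_betw h {0..<m} U" unfolding m_def using ex_bij_betw_nat_finite by blast
  then have inj: "inj_on h {0..<m}" and img: "h ` {0..<m} = U" by (auto simp: bij_betw_def)
  define K :: "nat graph" where "K = ({0..<m}, {e. e \<subseteq> {0..<m} \<and> h ` e \<in> edges G})"
  have card_h: "card (h ` e) = card e" if "e \<subseteq> {0..<m}" for e
    using inj that by (meson card_image inj_on_subset)
  have "wf_graph K"
    unfolding wf_graph_def
  proof (intro conjI ballI)
    fix e assume "e \<in> edges K"
    then have e: "e \<subseteq> {0..<m}" "h ` e \<in> edges G" by (auto simp: K_def)
    then show "e \<subseteq> verts K" by (simp add: K_def)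
    show "card e = 2" using card_h[OF e(1)] wf_graph_edge_card[OF G e(2)] by simp
  qed (simp add: K_def)
  then have K: "K \<in> graphs_on m" by (simp add: graphs_on_def K_def)
  have emb: "embedding h K G"
    using inj img U(1) by (auto simp: embedding_def K_def)
  have "image h ` edges K = {e \<in> edges G. e \<subseteq> U}"
  proof (intro equalityI subsetI)
    fix e assume "e \<in> image h ` edges K"
    then show "e \<in> {e \<in> edges G. e \<subseteq> U}" using img by (auto simp: K_def)
  next
    fix e assume e: "e \<in> {e \<in> edges G. e \<subseteq> U}"
    then have "e \<subseteq> h ` {0..<m}" using img by simp
    then obtain d where "d \<subseteq> {0..<m}" "e = h ` d" by (meson subset_imageE)
    then show "e \<in> image h ` edges K" using e by (auto simp: K_def)
  qed
  moreover have "inj_on (image h) (edges K)"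
    by (rule inj_on_subset[OF inj_on_image_Pow[OF inj]]) (auto simp: K_def)
  ultimately have edges: "card {e \<in> edges G. e \<subseteq> U} = card (edges K)"
    by (metis card_image)
  have "m \<le> card (neighbours K v) + m div r + 2" if v: "v \<in> verts K" for v
  proof -
    have hv: "v < m" "h v \<in> U" using v img by (auto simp: K_def)
    have "{w \<in> U. {h v, w} \<in> edges G} \<subseteq> h ` neighbours K v"
      using hv(1) by (auto simp: img[symmetric] neighbours_def K_def)
    then have "card {w \<in> U. {h v, w} \<in> edges G} \<le> card (neighbours K v)"
      using finite_neighbours[OF \<open>wf_graph K\<close>] by (meson card_image_le card_mono finite_imageI order_trans)
    then show ?thesis using U(4)[OF hv(2)] unfolding m_def[symmetric] by linarith
  qed
  then show ?thesis
    using that[of m K h] K emb U(2,3) unfolding edges m_def[symmetric] by blast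
qed

text \<open>Double counting of ordered missing pairs: each counted vertex starts at least
  \<open>Suc d\<close> of them, and each member of \<open>M\<close> yields at most two.\<close>

lemma card_many_missing_le:
  assumes "finite V" "finite M"
    and M: "\<And>v w. v \<in> V \<Longrightarrow> w \<in> V \<Longrightarrow> p w \<noteq> p v \<Longrightarrow> {v, w} \<notin> E \<Longrightarrow> {v, w} \<in> M"
    and two: "\<And>e. e \<in> M \<Longrightarrow> card e = 2"
  shows "card {v \<in> V. d < card {w \<in> V. p w \<noteq> p v \<and> {v, w} \<notin> E}} * Suc d \<le> 2 * card M"
proof -
  let ?miss = "\<lambda>v. {w \<in> V. p w \<noteq> p v \<and> {v, w} \<notin> E}"
  let ?S = "{v \<in> V. d < card (?miss v)}"
  have "card ?S * Suc d \<le> (\<Sum>v\<in>?S. card (?miss v))"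
    using sum_mono[of ?S "\<lambda>_. Suc d" "\<lambda>v. card (?miss v)"] by simp
  also have "\<dots> = card (Sigma ?S ?miss)"
    using assms(1) by (intro card_SigmaI[symmetric]) auto
  also have "\<dots> \<le> card (\<Union>e\<in>M. {(v, w). e = {v, w}})"
  proof (rule card_mono)
    have "{(v, w). e = {v, w}} \<subseteq> e \<times> e" for e :: "'a set" by auto
    moreover have "finite e" if "e \<in> M" for e using two[OF that] by (metis card.infinite zero_neq_numeral)
    ultimately have "finite {(v, w). e = {v, w}}" if "e \<in> M" for e
      using that by (meson finite_SigmaI finite_subset)
    then show "finite (\<Union>e\<in>M. {(v, w). e = {v, w}})" using assms(2) by blast
    show "Sigma ?S ?miss \<subseteq> (\<Union>e\<in>M. {(v, w). e = {v, w}})" using M by auto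
  qed
  also have "\<dots> \<le> (\<Sum>e\<in>M. card {(v, w). e = {v, w}})" by (rule card_UN_le[OF assms(2)])
  also have "\<dots> \<le> (\<Sum>e\<in>M. 2)"
  proof (rule sum_mono)
    fix e assume "e \<in> M"
    then obtain x y where "e = {x, y}" using two by (meson card_2_iff)
    then have "{(v, w). e = {v, w}} \<subseteq> {(x, y), (y, x)}" by (auto simp: doubleton_eq_iff)
    then have "card {(v, w). e = {v, w}} \<le> card {(x, y), (y, x)}" by (rule card_mono[rotated]) simp
    also have "\<dots> \<le> 2" by (rule card_insert_le_m1) simp_all
    finally show "card {(v, w). e = {v, w}} \<le> 2" .
  qed
  finally show ?thesis by simp
qed

section \<open>Chromatic number, extremal graphs and the critical edge\<close>

lemma finite_graphs_on: "finite (graphs_on n)"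
proof (rule finite_subset)
  show "graphs_on n \<subseteq> {{0..<n}} \<times> Pow (Pow {0..<n})"
  proof
    fix G assume "G \<in> graphs_on n"
    then have "fst G = {0..<n}" "snd G \<subseteq> Pow {0..<n}"
      using wf_graph_edge_subset[of G] by (auto simp: graphs_on_def verts_def edges_def)
    then show "G \<in> {{0..<n}} \<times> Pow (Pow {0..<n})" by (simp add: mem_Times_iff)
  qed
qed simp

text \<open>\<open>chromatic\<close> is given by \<open>LEAST\<close>, so some colouring must be
  exhibited before the minimum is known to be attained; an injective one serves.\<close>

lemma ex_proper_coloring_chromatic:
  assumes "wf_graph G"
  shows "\<exists>c. proper_coloring G (chromatic G) c"
proof -
  obtain h where h: "bij_betw h (verts G) {0..<card (verts G)}"
    using ex_bij_betw_finite_nat[OF wf_graph_finite[OF assms]] by blast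
  have "h u \<noteq> h v" if "{u, v} \<in> edges G" for u v
    using wf_graph_edgeD[OF assms that] h by (auto simp: bij_betw_def dest: inj_onD)
  then have "proper_coloring G (card (verts G)) h"
    using h by (auto simp: proper_coloring_def bij_betw_def)
  then have "\<exists>k c. proper_coloring G k c" by blast
  from LeastI_ex[OF this] show ?thesis by (simp only: chromatic_def)
qed

lemma free_turan_graph:
  assumes "wf_graph F" "chromatic F = r + 1" "r > 0"
  shows "free F (turan_graph n r)"
proof -
  have False if g: "embedding g F (turan_graph n r)" for g
  proof -
    have "proper_coloring F r (\<lambda>x. g x mod r)"
      unfolding proper_coloring_def
    proof (intro conjI allI impI)
      fix u v assume "{u, v} \<in> edges F"
      then have "g ` {u, v} \<in> edges (turan_graph n r)" using g by (auto simp: embedding_def)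
      then show "g u mod r \<noteq> g v mod r" by (simp add: turan_graph_edge_iff)
    qed (use assms(3) in auto)
    then have "chromatic F \<le> r" unfolding chromatic_def by (intro Least_le exI)
    then show False using assms(2) by simp
  qed
  then show ?thesis using free_iff_no_embedding[OF assms(1) wf_turan_graph] by blast
qed

lemma count_copies_le_gen_ex:
  assumes "G \<in> graphs_on n" "free F G"
  shows "count_copies H G \<le> gen_ex n H F"
  unfolding gen_ex_def using assms finite_graphs_on[of n] by (intro Max_ge) auto

text \<open>If no graph T(n, r) + e contained F, then placing a leaf edge of H on e would produce an F-free
  graph with more copies of H than T(n, r).\<close>
lemma turan_good_critical_edge:
  assumes F: "wf_graph F" and H: "wf_graph H" and forest: "forest H" and "edges H \<noteq> {}"
    and chH: "chromatic H \<le> r" and chF: "chromatic F = r + 1" and r: "r > 0" and good: "turan_good H F"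
  obtains n a b g where "a < n" "b < n" "a mod r = b mod r" "a \<noteq> b"
    "embedding g F (add_edge (turan_graph n r) {a, b})"
proof -
  obtain u v where uv: "neighbours H u = {v}" using forest_has_leaf[OF H forest \<open>edges H \<noteq> {}\<close>] .
  have uvE: "{u, v} \<in> edges H" using uv by (auto simp: neighbours_def)
  note uvV = wf_graph_edgeD[OF H uvE]
  obtain c where c: "proper_coloring H (chromatic H) c" using ex_proper_coloring_chromatic[OF H] by blast
  have c_less: "c x < r" if "x \<in> verts H" for x
    using c that chH by (fastforce simp: proper_coloring_def)
  have c_ne: "c x \<noteq> c y" if "{x, y} \<in> edges H" for x y
    using c that by (auto simp: proper_coloring_def)
  define k where "k = card (verts H)"
  obtain idx where idx: "bij_betw idx (verts H) {0..<k}"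
    using ex_bij_betw_finite_nat[OF wf_graph_finite[OF H]] unfolding k_def by blast
  obtain n0 where n0: "\<And>n. n \<ge> n0 \<Longrightarrow> gen_ex n H F = count_copies H (turan_graph n r)"
    using good chF by (auto simp: turan_good_def)
  define n where "n = max n0 (r * k)"
  \<comment> \<open>Giving the leaf \<open>u\<close> the colour of its only neighbour makes
    \<open>{u, v}\<close> the only edge of \<open>H\<close> inside a colour class.\<close>
  define col where "col x = (if x = u then c v else c x)" for x
  \<comment> \<open>The colour becomes the residue modulo \<open>r\<close> and the index becomes the
    quotient, so \<open>f\<close> is injective and respects the Turan classes. Its values stay below
    \<open>r * k\<close>, which is why \<open>n\<close> is at least that large.\<close>
  define f where "f x = col x + r * idx x" for x
  have col_less: "col x < r" if "x \<in> verts H" for x using c_less that uvV by (simp add: col_def)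
  have f_mod: "f x mod r = col x" if "x \<in> verts H" for x using col_less[OF that] by (simp add: f_def)
  have f_div: "f x div r = idx x" if "x \<in> verts H" for x using col_less[OF that] by (simp add: f_def)
  have f_less: "f x < n" if x: "x \<in> verts H" for x
  proof -
    have "idx x < k" using idx x by (auto simp: bij_betw_def)
    then have "r * Suc (idx x) \<le> r * k" by (intro mult_le_mono2) simp
    then show ?thesis using col_less[OF x] by (simp add: f_def n_def)
  qed
  have f_inj: "inj_on f (verts H)"
    using f_div idx by (metis (no_types, lifting) bij_betw_def inj_on_def)
  define a b where "a = f u" and "b = f v"
  have ab: "a < n" "b < n" "a mod r = b mod r" "a \<noteq> b"
    using f_less f_mod uvV f_inj by (auto simp: a_def b_def col_def dest: inj_onD)
  let ?T = "turan_graph n r"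
  let ?T' = "add_edge ?T {a, b}"
  have wfT': "wf_graph ?T'" using ab wf_turan_graph[of n r] by (auto simp: wf_graph_def)
  then have T': "?T' \<in> graphs_on n" by (simp add: graphs_on_def)
  have "f ` e \<in> edges ?T'" if e: "e \<in> edges H" for e
  proof (cases "u \<in> e")
    case True
    obtain x y where xy: "e = {x, y}" "x \<noteq> y" using wf_graph_edgeE[OF H e] by blast
    then obtain w where w: "e = {u, w}" using True by blast
    then have "w \<in> neighbours H u" using e by (simp add: neighbours_def)
    then show ?thesis using w uv by (simp add: a_def b_def)
  next
    case False
    obtain x y where xy: "e = {x, y}" "x \<in> verts H" "y \<in> verts H" using wf_graph_edgeE[OF H e] by blast
    then have "f x mod r \<noteq> f y mod r" using f_mod False c_ne[of x y] e by (auto simp: col_def)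
    then show ?thesis using xy f_less by (simp add: turan_graph_edge_iff)
  qed
  then have "embedding f H ?T'" using f_inj f_less by (auto simp: embedding_def)
  then have in_T': "restrict f (verts H) \<in> embeddings H ?T'" by (rule restrict_embedding[OF H])
  have not_T: "restrict f (verts H) \<notin> embeddings H ?T"
  proof
    assume "restrict f (verts H) \<in> embeddings H ?T"
    then have "restrict f (verts H) ` {u, v} \<in> edges ?T" using uvE by (auto simp: embeddings_def embedding_def)
    then show False using ab(3) uvV by (simp add: turan_graph_edge_iff a_def b_def)
  qed
  have "embeddings H ?T \<subseteq> embeddings H ?T'" by (auto simp: embeddings_def embedding_def)
  then have "card (embeddings H ?T) < card (embeddings H ?T')"
    using in_T' not_T by (intro psubset_card_mono finite_embeddings[OF H wfT']) blast
  then have more: "count_copies H ?T < count_copies H ?T'"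
    by (simp add: card_embeddings_eq[OF H wf_turan_graph] card_embeddings_eq[OF H wfT'])
  have "\<not> free F ?T'"
  proof
    assume "free F ?T'"
    then have "count_copies H ?T' \<le> gen_ex n H F" by (rule count_copies_le_gen_ex[OF T'])
    then show False using more n0[of n] by (simp add: n_def)
  qed
  then show thesis using that[OF ab] free_iff_no_embedding[OF F wfT'] by blast
qed

lemma card_neighbours_turan_graph_le:
  assumes "v < m" "r > 0"
  shows "card (neighbours (turan_graph m r) v) + m div r \<le> m"
proof -
  let ?C = "{w. w < m \<and> w mod r = v mod r}"
  have "card (neighbours (turan_graph m r) v) + card ?C = card (neighbours (turan_graph m r) v \<union> ?C)"
    by (intro card_Un_disjoint[symmetric] finite_neighbours wf_turan_graph)
      (auto simp: neighbours_def turan_graph_edge_iff)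
  also have "\<dots> \<le> card {0..<m}"
    by (intro card_mono) (auto simp: neighbours_def turan_graph_edge_iff)
  finally show ?thesis using card_residue_class_ge[of "v mod r" r m] assms(2) by simp
qed

lemma biex_bounded_imp_chromatic:
  assumes "chromatic F = r + 1" "\<exists>C. \<forall>n. biex n F \<le> C"
  shows "r > 0"
proof (rule ccontr)
  assume "\<not> r > 0"
  then have "decomp_family F = {}" using assms(1) by (auto simp: decomp_family_def)
  then have biex: "biex n F = Max ((\<lambda>G. card (edges G)) ` graphs_on n)" for n
    by (simp add: biex_def)
  obtain C where C: "\<And>n. biex n F \<le> C" using assms(2) by blast
  let ?n = "C + 2"
  let ?S = "({0..<?n}, (\<lambda>i. {0, i}) ` {1..<?n})"
  have "?S \<in> graphs_on ?n" by (auto simp: graphs_on_def wf_graph_def card_insert_if)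
  then have "card (edges ?S) \<le> biex ?n F"
    unfolding biex by (intro Max_ge finite_imageI finite_graphs_on) (rule imageI)
  moreover have "card (edges ?S) = C + 1"
    by (subst edges_Pair, subst card_image) (auto simp: inj_on_def doubleton_eq_iff)
  ultimately show False using C[of ?n] by simp
qed

section \<open>The Turan number of F\<close>

text \<open>Dividing by the number of automorphisms, which is at least 1, cannot increase the error
  term, so the constant found for embeddings also serves for copies.\<close>

lemma count_copies_forest_le:
  fixes H :: "'a graph"
  assumes H: "wf_graph H" and forest: "forest H"
  obtains C where "\<And>n D (G :: 'b graph) (T :: 'c graph). \<lbrakk>wf_graph G; wf_graph T;
     card (verts G) = n; card (verts T) = n; n > 0; D \<le> n;
     \<forall>v\<in>verts G. D \<le> card (neighbours G v); \<forall>v\<in>verts T. card (neighbours T v) \<le> D + 3\<rbrakk> \<Longrightarrow>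
     n * count_copies H T \<le> n * count_copies H G + C * n ^ card (verts H)"
proof -
  obtain C where C: "\<forall>n D (G :: 'b graph) (T :: 'c graph). wf_graph G \<and> wf_graph T \<and>
     card (verts G) = n \<and> card (verts T) = n \<and> n > 0 \<and> D \<le> n \<and>
     (\<forall>v\<in>verts G. D \<le> card (neighbours G v)) \<and> (\<forall>v\<in>verts T. card (neighbours T v) \<le> D + 3) \<longrightarrow>
     n * card (embeddings H T) \<le> n * card (embeddings H G) + C * n ^ card (verts H)"
    using card_embeddings_forest_le[OF H forest] by blast
  show thesis
  proof (rule that[of C])
    fix n D :: nat and G :: "'b graph" and T :: "'c graph"
    assume G: "wf_graph G" and T: "wf_graph T" and rest: "card (verts G) = n" "card (verts T) = n" "n > 0" "D \<le> n"
      "\<forall>v\<in>verts G. D \<le> card (neighbours G v)" "\<forall>v\<in>verts T. card (neighbours T v) \<le> D + 3"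
    let ?A = "card (automorphisms H)" and ?c = "C * n ^ card (verts H)"
    have "n * card (embeddings H T) \<le> n * card (embeddings H G) + ?c"
      using C G T rest by blast
    then have "?A * (n * count_copies H T) \<le> ?A * (n * count_copies H G) + ?c"
      by (simp add: card_embeddings_eq[OF H G] card_embeddings_eq[OF H T] mult.left_commute)
    also have "\<dots> \<le> ?A * (n * count_copies H G + ?c)"
      using card_automorphisms_pos[OF H] by (simp add: distrib_left)
    finally show "n * count_copies H T \<le> n * count_copies H G + ?c"
      using card_automorphisms_pos[OF H] by simp
  qed
qed

lemma ex_le_turan_edges:
  fixes F H :: "'a graph"
  assumes F: "wf_graph F" and H: "wf_graph H" and forest: "forest H" and "edges H \<noteq> {}"
    and chH: "chromatic H \<le> r" and chF: "chromatic F = r + 1" and r: "r > 0"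
    and stable: "turan_stable H F" and good: "turan_good H F"
  shows "\<exists>n0. \<forall>n\<ge>n0. \<forall>G\<in>graphs_on n. free F G \<longrightarrow> card (edges G) \<le> card (edges (turan_graph n r))"
proof -
  obtain l a b g where ab: "a < l" "b < l" "a mod r = b mod r" "a \<noteq> b"
    and g: "embedding g F (add_edge (turan_graph l r) {a, b})"
    using turan_good_critical_edge[OF F H forest \<open>edges H \<noteq> {}\<close> chH chF r good] .
  define k where "k = card (verts H)"
  \<comment> \<open>\<open>c1 * d + c2\<close> is the part size required by the colouring argument,
    written as an affine function of the tolerance \<open>d\<close>.\<close>
  define c1 where "c1 = 3 * (r * Suc l + 1)"
  define c2 where "c2 = 3 * Suc l + 6"
  \<comment> \<open>With \<open>d = m div L\<close>, the product \<open>c1 * d * r\<close> is at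
    most half of \<open>m\<close>; the entry \<open>2 * r * c2\<close> of \<open>M\<close> bounds
    \<open>c2 * r\<close> by the other half.\<close>
  define L where "L = 2 * c1 * r"
  \<comment> \<open>Edit distance at most \<open>\<epsilon> * m^2\<close> leaves at most
    \<open>2 * \<epsilon> * m^2 / (d + 1)\<close> vertices with more than \<open>d\<close> missing
    cross edges. As \<open>d + 1\<close> is at least \<open>m / L\<close>, this is at most
    \<open>m / L\<close>, and by integrality at most \<open>d\<close>.\<close>
  define \<epsilon> where "\<epsilon> = 1 / (2 * real L ^ 2)"
  have L: "L > 0" using r by (simp add: L_def c1_def)
  then have "\<epsilon> > 0" by (simp add: \<epsilon>_def)
  then obtain \<delta> n1 where \<delta>: "\<delta> > 0" and n1: "\<And>n G. \<lbrakk>n \<ge> n1; G \<in> graphs_on n; free F G;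
      real (gen_ex n H F) - \<delta> * real n ^ k \<le> real (count_copies H G)\<rbrakk> \<Longrightarrow>
      \<exists>T\<in>graphs_on n. graph_iso T (turan_graph n r) \<and> real (edit_distance G T) \<le> \<epsilon> * real n ^ 2"
    using stable chF unfolding turan_stable_def k_def by fastforce
  obtain n2 where n2: "\<And>n. n \<ge> n2 \<Longrightarrow> gen_ex n H F = count_copies H (turan_graph n r)"
    using good chF by (auto simp: turan_good_def)
  obtain C where C: "\<And>n D (G :: nat graph) (T :: nat graph). \<lbrakk>wf_graph G; wf_graph T;
     card (verts G) = n; card (verts T) = n; n > 0; D \<le> n;
     \<forall>v\<in>verts G. D \<le> card (neighbours G v); \<forall>v\<in>verts T. card (neighbours T v) \<le> D + 3\<rbrakk> \<Longrightarrow>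
     n * count_copies H T \<le> n * count_copies H G + C * n ^ k"
    using count_copies_forest_le[OF H forest] unfolding k_def by blast
  \<comment> \<open>From \<open>C / \<delta>\<close> vertices on, the counting error
    \<open>C * m ^ k\<close> is absorbed by \<open>\<delta> * m ^ k\<close> after division by
    \<open>m\<close>; the entry 1 keeps \<open>m\<close> positive for that division.\<close>
  define M where "M = Max {n1, n2, nat \<lceil>real C / \<delta>\<rceil>, 2 * r * c2, 1}"
  have M: "n1 \<le> M" "n2 \<le> M" "nat \<lceil>real C / \<delta>\<rceil> \<le> M" "2 * r * c2 \<le> M" "1 \<le> M"
    unfolding M_def by (rule Max_ge; simp)+
  have "card (edges G) \<le> card (edges (turan_graph n r))"
    if n: "M * M + M \<le> n" and G: "G \<in> graphs_on n" and free: "free F G" for n G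
  proof (rule ccontr)
    assume "\<not> ?thesis"
    then have many: "card (edges (turan_graph n r)) < card (edges G)" by simp
    have wfG: "wf_graph G" and cG: "card (verts G) = n" using G by (auto simp: graphs_on_def)
    obtain m K h where m: "M \<le> m" and K: "K \<in> graphs_on m" and h: "embedding h K G"
      and dense: "card (edges (turan_graph m r)) < card (edges K)"
      and deg: "\<And>v. v \<in> verts K \<Longrightarrow> m \<le> card (neighbours K v) + m div r + 2"
      using ex_dense_subgraph[OF wfG cG many n] by blast
    have wfK: "wf_graph K" and VK: "verts K = {0..<m}" using K by (auto simp: graphs_on_def)
    have noF: "\<not> embedding f F K" for f
      using embedding_comp[OF _ h, of f F] free free_iff_no_embedding[OF F wfG] by blast
    have no_emb: "\<not> embedding f (add_edge (turan_graph l r) {a, b}) K" for f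
      using embedding_comp[OF g] noF by blast
    have m0: "m > 0" using m M(5) by simp
    \<comment> \<open>Degrees in \<open>K\<close> are at least \<open>m - m div r - 2\<close> and
      degrees in the Turan graph at most \<open>m - m div r\<close>, within the gap of 3 that the
      comparison of copies admits.\<close>
    have "m * count_copies H (turan_graph m r) \<le> m * count_copies H K + C * m ^ k"
    proof (rule C[OF wfK wf_turan_graph, where D = "m - m div r - 2"])
      show "\<forall>v\<in>verts K. m - m div r - 2 \<le> card (neighbours K v)" using deg by fastforce
      show "\<forall>v\<in>verts (turan_graph m r). card (neighbours (turan_graph m r) v) \<le> m - m div r - 2 + 3"
        using card_neighbours_turan_graph_le[OF _ r, of _ m] by fastforce
    qed (use VK m0 in auto)
    then have "real m * real (count_copies H (turan_graph m r)) \<le> real m * real (count_copies H K) + real C * real m ^ k"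
      by (metis of_nat_add of_nat_le_iff of_nat_mult of_nat_power)
    moreover have "real C * real m ^ k \<le> real m * (\<delta> * real m ^ k)"
    proof -
      have "real C / \<delta> \<le> real (nat \<lceil>real C / \<delta>\<rceil>)" by (rule real_nat_ceiling_ge)
      also have "\<dots> \<le> real m" using M(3) m by (intro of_nat_mono) (rule order_trans)
      finally have "real C / \<delta> \<le> real m" .
      then have "real C \<le> real m * \<delta>" using \<delta> by (simp add: field_simps)
      then show ?thesis using mult_right_mono[of "real C" "real m * \<delta>" "real m ^ k"] by simp
    qed
    ultimately have "real m * real (count_copies H (turan_graph m r)) \<le> real m * (real (count_copies H K) + \<delta> * real m ^ k)"
      by (simp add: distrib_left)
    then have "real (count_copies H (turan_graph m r)) \<le> real (count_copies H K) + \<delta> * real m ^ k"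
      using m0 by simp
    then have "real (gen_ex m H F) - \<delta> * real m ^ k \<le> real (count_copies H K)"
      using n2[of m] m M(2) by simp
    moreover have "free F K" using noF free_iff_no_embedding[OF F wfK] by blast
    ultimately obtain T where T: "T \<in> graphs_on m" "graph_iso T (turan_graph m r)"
      and ed: "real (edit_distance K T) \<le> \<epsilon> * real m ^ 2"
      using n1[OF _ K] m M(1) by force
    have wfT: "wf_graph T" and VT: "verts T = {0..<m}" using T(1) by (auto simp: graphs_on_def)
    obtain f where f: "bij_betw f {0..<m} {0..<m}"
      and fE: "\<And>e. e \<subseteq> {0..<m} \<Longrightarrow> e \<in> edges T \<longleftrightarrow> f ` e \<in> edges (turan_graph m r)"
      using T(2) VT by (auto simp: graph_iso_def)
    \<comment> \<open>The residue classes of the Turan graph are pulled back along the isomorphism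
      \<open>f\<close>, so that \<open>p\<close> is the partition of the graph \<open>T\<close>
      close to \<open>K\<close>.\<close>
    define p where "p v = f v mod r" for v
    define d where "d = m div L"
    have "\<exists>q. q ` verts K \<subseteq> {..<r} \<and> (\<forall>u v. {u, v} \<in> edges K \<longrightarrow> q u \<noteq> q v)"
    proof (rule near_turan_colourable[OF wfK r ab no_emb, where p = p and s = "m div r" and d = d])
      show "card (verts K) \<le> card (neighbours K v) + m div r + 2" if "v \<in> verts K" for v
        using deg[OF that] VK by simp
      show "m div r \<le> card {v \<in> verts K. p v = i}" if "i < r" for i
      proof -
        have "{w. w < m \<and> w mod r = i} \<subseteq> f ` {v \<in> verts K. p v = i}"
        proof
          fix w assume w: "w \<in> {w. w < m \<and> w mod r = i}"
          then have "w \<in> f ` {0..<m}" using f by (simp add: bij_betw_def)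
          then obtain v where "v < m" "w = f v" by auto
          then show "w \<in> f ` {v \<in> verts K. p v = i}" using w VK by (auto simp: p_def)
        qed
        then have "card {w. w < m \<and> w mod r = i} \<le> card {v \<in> verts K. p v = i}"
          using VK by (intro surj_card_le) auto
        then show ?thesis using card_residue_class_ge[OF that, of m] by simp
      qed
      show "card {v \<in> verts K. d < card {w \<in> verts K. p w \<noteq> p v \<and> {v, w} \<notin> edges K}} \<le> d"
        (is "card ?S \<le> d")
      proof -
        have "card ?S * Suc d \<le> 2 * card (edges T - edges K)"
        proof (rule card_many_missing_le)
          show "finite (verts K)" "finite (edges T - edges K)"
            using wf_graph_finite[OF wfK] wf_graph_finite_edges[OF wfT] by auto
          show "card e = 2" if "e \<in> edges T - edges K" for e
            using that wf_graph_edge_card[OF wfT] by simp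
          fix v w assume vw: "v \<in> verts K" "w \<in> verts K" "p w \<noteq> p v" "{v, w} \<notin> edges K"
          have "f v < m" "f w < m" using f vw(1,2) VK by (auto simp: bij_betw_def)
          then have "{v, w} \<in> edges T"
            using fE[of "{v, w}"] vw VK by (simp add: turan_graph_edge_iff p_def)
          then show "{v, w} \<in> edges T - edges K" using vw(4) by simp
        qed
        also have "\<dots> \<le> 2 * edit_distance K T" by (simp add: edit_distance_def)
        finally have "real (card ?S * Suc d) \<le> 2 * (\<epsilon> * real m ^ 2)" using ed by linarith
        moreover have "m \<le> Suc d * L"
          using dividend_less_times_div[OF L, of m] by (simp add: d_def mult.commute)
        then have "card ?S * m \<le> card ?S * (Suc d * L)" by (rule mult_le_mono2)
        then have "card ?S * m \<le> card ?S * Suc d * L" by (simp only: mult.assoc)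
        then have "real (card ?S) * real m \<le> real (card ?S * Suc d) * real L"
          unfolding of_nat_mult[symmetric] of_nat_le_iff .
        ultimately have "real (card ?S) * real m \<le> 2 * (\<epsilon> * real m ^ 2) * real L"
          using mult_right_mono[of "real (card ?S * Suc d)" "2 * (\<epsilon> * real m ^ 2)" "real L"] by linarith
        also have "\<dots> = real m * real m / real L"
          using L by (simp add: \<epsilon>_def power2_eq_square)
        finally have "real (card ?S) * real m * real L \<le> real m * real m"
          using L by (simp add: field_simps)
        then have "real m * (real (card ?S) * real L) \<le> real m * real m" by (simp add: ac_simps)
        then have "real (card ?S) * real L \<le> real m" using m0 by simp
        then have "card ?S * L \<le> m" unfolding of_nat_mult[symmetric] of_nat_le_iff .
        then show ?thesis unfolding d_def using L by (simp add: less_eq_div_iff_mult_less_eq)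
      qed
      show "3 * (r * Suc l * d + Suc l + d) + 6 \<le> m div r"
      proof -
        have "2 * (c1 * r * d) \<le> m"
          using times_div_less_eq_dividend[of L m] by (simp add: d_def L_def mult.assoc)
        moreover have "2 * (r * c2) \<le> m" using m M(4) by simp
        ultimately have "(c1 * d + c2) * r \<le> m" by (simp add: algebra_simps)
        then have "c1 * d + c2 \<le> m div r" using r by (simp add: less_eq_div_iff_mult_less_eq)
        moreover have "c1 * d + c2 = 3 * (r * Suc l * d + Suc l + d) + 6"
          by (simp add: c1_def c2_def algebra_simps)
        ultimately show ?thesis by simp
      qed
    qed
    then obtain q where "q ` verts K \<subseteq> {..<r}" "\<And>u v. {u, v} \<in> edges K \<Longrightarrow> q u \<noteq> q v" by blast
    then have "card {e \<in> edges K. e \<subseteq> verts K} \<le> card (edges (turan_graph (card (verts K)) r))"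
      using wf_graph_finite_edges[OF wfK] wf_graph_edge_card[OF wfK] wf_graph_finite[OF wfK]
      by (intro card_edges_partite_le) auto
    then show False using dense unfolding edges_within_eq[OF wfK] by (simp add: VK)
  qed
  then show ?thesis by blast
qed

text \<open>Without edges an embedding is merely an injection of vertex sets.\<close>

lemma count_copies_edgeless:
  assumes "wf_graph H" "edges H = {}" "verts G = verts K"
  shows "count_copies H G = count_copies H K"
proof -
  have "embeddings H G = embeddings H K" using assms by (simp add: embeddings_def embedding_def)
  then show ?thesis unfolding count_copies_def copies_eq_image[OF assms(1)] by simp
qed

theorem theorem1p6:
  fixes F H :: "'a graph" and r :: nat
  assumes "wf_graph F" and "wf_graph H"
    and "chromatic F = r + 1" and "chromatic H < r + 1"
    and "forest H"
    and "turan_stable H F" and "turan_good H F"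
    and "\<exists>C. \<forall>n. biex n F \<le> C"
  shows "\<exists>n0. \<forall>n\<ge>n0. \<exists>G\<in>graphs_on n. free F G \<and> card (edges G) = ex n F \<and>
            gen_ex n H F = count_copies H G"
proof -
  have r: "r > 0" using biex_bounded_imp_chromatic assms(3,8) .
  have T: "turan_graph n r \<in> {G \<in> graphs_on n. free F G}" for n
    using turan_graph_in_graphs_on free_turan_graph[OF assms(1,3) r] by simp
  have fin: "finite {G \<in> graphs_on n. free F G}" for n using finite_graphs_on[of n] by simp
  obtain n1 where n1: "\<And>n. n \<ge> n1 \<Longrightarrow> gen_ex n H F = count_copies H (turan_graph n r)"
    using assms(3,7) by (auto simp: turan_good_def)
  show ?thesis
  proof (cases "edges H = {}")
    case True
    show ?thesis
    proof (intro exI[of _ n1] allI impI)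
      fix n assume n: "n \<ge> n1"
      have "ex n F \<in> (\<lambda>G. card (edges G)) ` {G \<in> graphs_on n. free F G}"
        unfolding ex_def using fin T by (intro Max_in) blast+
      then obtain G where G: "G \<in> graphs_on n" "free F G" "card (edges G) = ex n F" by auto
      have "gen_ex n H F = count_copies H G"
        unfolding n1[OF n] using G(1) by (intro count_copies_edgeless[OF assms(2) True]) (simp add: graphs_on_def)
      then show "\<exists>G\<in>graphs_on n. free F G \<and> card (edges G) = ex n F \<and> gen_ex n H F = count_copies H G"
        using G by blast
    qed
  next
    case False
    then obtain n2 where n2: "\<And>n G. n \<ge> n2 \<Longrightarrow> G \<in> graphs_on n \<Longrightarrow> free F G \<Longrightarrow>
        card (edges G) \<le> card (edges (turan_graph n r))"
      using ex_le_turan_edges[OF assms(1,2,5) False _ assms(3) r assms(6,7)] assms(4) by auto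
    show ?thesis
    proof (intro exI[of _ "max n1 n2"] allI impI)
      fix n assume n: "n \<ge> max n1 n2"
      have "ex n F = card (edges (turan_graph n r))"
        unfolding ex_def using n n2 fin T[of n] by (intro Max_eqI) auto
      then show "\<exists>G\<in>graphs_on n. free F G \<and> card (edges G) = ex n F \<and> gen_ex n H F = count_copies H G"
        using n n1[of n] T[of n] by (intro bexI[of _ "turan_graph n r"]) auto
    qed
  qed
qed

end
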